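(* Let $(G,H)$ be a Camina pair, where $G$ is a finite group. If $H$ and $G/H$ are generalized Schur groups, then $G$ is a generalized Schur group. In particular, a finite Frobenius group whose Frobenius kernel and Frobenius complement are generalized Schur is generalized Schur.
   Context: All groups are finite. For a group $G$ with identity $e$ and $X\subseteq G$, write $\underline{X}=\sum_{x\in X}x\in\mathbb{Z}G$ and $X^{-1}=\{x^{-1}:x\in X\}$. A subring $\mathcal{A}\subseteq\mathbb{Z}G$ is an $S$-ring over $G$ if there is a partition $\mathcal{S}(\mathcal{A})$ of $G$ such that $\{e\}\in\mathcal{S}(\mathcal{A})$; $X\in\mathcal{S}(\mathcal{A})$ implies $X^{-1}\in\mathcal{S}(\mathcal{A})$; and $\mathcal{A}=\mathrm{Span}_{\mathbb{Z}}\{\underline{X}:X\in\mathcal{S}(\mathcal{A})\}$. The $S$-ring $\mathcal{A}$ is schurian if there is a subgroup $K\leq\mathrm{Sym}(G)$ containing all right translations of $G$ such that $\mathcal{S}(\mathcal{A})$ is the set of orbits on $G$ of the stabilizer $K_e$ of $e$ in $K$. The $S$-ring $\mathcal{A}$ is central if $\mathcal{A}\subseteq Z(\mathbb{Z}G)$, equivalently if every $X\in\mathcal{S}(\mathcal{A})$ is a union of conjugacy classes of $G$. A group $G$ is generalized Schur if every central $S$-ring over $G$ is schurian. A pair $(G,H)$ is a Camina pair if $H$ is a proper nontrivial normal subgroup of $G$ such that each $H$-coset distinct from $H$ is contained in a conjugacy class of $G$. *)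

theory Defs
  imports
    "HOL-Algebra.Group_Action"
    "HOL-Algebra.Subrings"
    "HOL-Library.Disjoint_Sets"
    "HOL-Library.Indicator_Function"
begin

section \<open>The integral group ring\<close>

text \<open>
  An element of the integral group ring of a finite group is represented by its coefficient
  function, which is zero outside the carrier.
  The sum \<open>\<Sum>x\<in>X. x\<close> is represented by \<open>indicator X\<close>.
\<close>

definition group_ring :: "('a, 'b) monoid_scheme \<Rightarrow> ('a \<Rightarrow> int) ring" where
  "group_ring G =
    \<lparr>carrier = {f. \<forall>x. x \<notin> carrier G \<longrightarrow> f x = 0},
     mult = (\<lambda>f g x. \<Sum>(y, z)\<in>{(y, z) \<in> carrier G \<times> carrier G. y \<otimes>\<^bsub>G\<^esub> z = x}. f y * g z),
     one = indicator {\<one>\<^bsub>G\<^esub>},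
     zero = (\<lambda>x. 0),
     add = (\<lambda>f g x. f x + g x)\<rparr>"

lemma group_ring_ring:
  fixes G (structure)
  assumes "group G" and fin: "finite (carrier G)"
  shows "ring (group_ring G)"
proof -
  interpret group G by fact
  let ?R = "group_ring G"
  have mult_nz: "(f \<otimes>\<^bsub>?R\<^esub> g) x = (\<Sum>y\<in>carrier G. f y * g (inv y \<otimes> x))"
    if x: "x \<in> carrier G" for f g x
  proof -
    have "{(y, z) \<in> carrier G \<times> carrier G. y \<otimes> z = x} = (\<lambda>y. (y, inv y \<otimes> x)) ` carrier G"
    proof -
      have "y \<in> carrier G \<Longrightarrow> z \<in> carrier G \<Longrightarrow> y \<otimes> z = x \<Longrightarrow> z = inv y \<otimes> x" for y z
        using inv_solve_left x by blast
      moreover have "y \<in> carrier G \<Longrightarrow> y \<otimes> (inv y \<otimes> x) = x" for y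
        using x by (metis inv_closed m_assoc r_inv l_one)
      ultimately show ?thesis using x by auto
    qed
    moreover have "inj_on (\<lambda>y. (y, inv y \<otimes> x)) (carrier G)"
      by (auto simp: inj_on_def)
    ultimately show ?thesis
      by (simp add: group_ring_def sum.reindex)
  qed
  have mult_z: "(f \<otimes>\<^bsub>?R\<^esub> g) x = 0" if "x \<notin> carrier G" for f g x
  proof -
    have "{(y, z) \<in> carrier G \<times> carrier G. y \<otimes> z = x} = {}"
      using that by auto
    then show ?thesis by (simp only: group_ring_def monoid.simps sum.empty)
  qed
  have car: "f \<in> carrier ?R \<longleftrightarrow> (\<forall>x. x \<notin> carrier G \<longrightarrow> f x = 0)" for f
    by (simp add: group_ring_def)
  have add: "f \<oplus>\<^bsub>?R\<^esub> g = (\<lambda>x. f x + g x)" for f g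
    by (simp add: group_ring_def)
  have one: "\<one>\<^bsub>?R\<^esub> = indicator {\<one>}" by (simp add: group_ring_def)
  have zero: "\<zero>\<^bsub>?R\<^esub> = (\<lambda>x. 0)" by (simp add: group_ring_def)
  have shift: "(\<Sum>y\<in>carrier G. h y) = (\<Sum>y\<in>carrier G. h (a \<otimes> y))" if "a \<in> carrier G" for a and h :: "_ \<Rightarrow> int"
    using sum.reindex_bij_betw[of "\<lambda>y. a \<otimes> y" "carrier G" "carrier G" h] that
    by (simp add: bij_betw_def inj_on_cmult surj_const_mult)
  show ?thesis
  proof (rule ringI)
    show "abelian_group ?R"
    proof (rule abelian_groupI)
      fix f assume "f \<in> carrier ?R"
      then show "\<exists>g\<in>carrier ?R. g \<oplus>\<^bsub>?R\<^esub> f = \<zero>\<^bsub>?R\<^esub>"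
        by (intro bexI[of _ "\<lambda>x. - f x"]) (auto simp: car add zero)
    qed (auto simp: car add zero fun_eq_iff)
    show "monoid ?R"
    proof (rule monoidI)
      show "\<one>\<^bsub>?R\<^esub> \<in> carrier ?R" by (auto simp: car one indicator_def)
    next
      fix f g assume "f \<in> carrier ?R" "g \<in> carrier ?R"
      then show "f \<otimes>\<^bsub>?R\<^esub> g \<in> carrier ?R" using mult_z by (simp add: car)
    next
      fix f g h
      show "f \<otimes>\<^bsub>?R\<^esub> g \<otimes>\<^bsub>?R\<^esub> h = f \<otimes>\<^bsub>?R\<^esub> (g \<otimes>\<^bsub>?R\<^esub> h)"
      proof
        fix x show "(f \<otimes>\<^bsub>?R\<^esub> g \<otimes>\<^bsub>?R\<^esub> h) x = (f \<otimes>\<^bsub>?R\<^esub> (g \<otimes>\<^bsub>?R\<^esub> h)) x"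
        proof (cases "x \<in> carrier G")
          case True
          have "(f \<otimes>\<^bsub>?R\<^esub> g \<otimes>\<^bsub>?R\<^esub> h) x =
              (\<Sum>z\<in>carrier G. \<Sum>y\<in>carrier G. f y * g (inv y \<otimes> z) * h (inv z \<otimes> x))"
            using True by (simp add: mult_nz sum_distrib_right)
          also have "\<dots> = (\<Sum>y\<in>carrier G. \<Sum>z\<in>carrier G. f y * g (inv y \<otimes> z) * h (inv z \<otimes> x))"
            by (rule sum.swap)
          also have "\<dots> = (\<Sum>y\<in>carrier G. \<Sum>z\<in>carrier G. f y * (g z * h (inv z \<otimes> (inv y \<otimes> x))))"
          proof (rule sum.cong[OF refl])
            fix y assume y: "y \<in> carrier G"
            show "(\<Sum>z\<in>carrier G. f y * g (inv y \<otimes> z) * h (inv z \<otimes> x)) =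
              (\<Sum>z\<in>carrier G. f y * (g z * h (inv z \<otimes> (inv y \<otimes> x))))"
            proof (subst shift[OF y], rule sum.cong[OF refl])
              fix z assume z: "z \<in> carrier G"
              have "inv y \<otimes> (y \<otimes> z) = z"
                using y z by (metis inv_closed l_inv l_one m_assoc)
              moreover have "inv (y \<otimes> z) \<otimes> x = inv z \<otimes> (inv y \<otimes> x)"
                using y z True by (simp add: inv_mult_group m_assoc)
              ultimately show "f y * g (inv y \<otimes> (y \<otimes> z)) * h (inv (y \<otimes> z) \<otimes> x) =
                f y * (g z * h (inv z \<otimes> (inv y \<otimes> x)))"
                by simp
            qed
          qed
          also have "\<dots> = (f \<otimes>\<^bsub>?R\<^esub> (g \<otimes>\<^bsub>?R\<^esub> h)) x"
            using True by (simp add: mult_nz sum_distrib_left)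
          finally show ?thesis .
        qed (simp add: mult_z)
      qed
    next
      fix f assume f: "f \<in> carrier ?R"
      show "\<one>\<^bsub>?R\<^esub> \<otimes>\<^bsub>?R\<^esub> f = f"
      proof
        fix x show "(\<one>\<^bsub>?R\<^esub> \<otimes>\<^bsub>?R\<^esub> f) x = f x"
        proof (cases "x \<in> carrier G")
          case True
          have "(\<one>\<^bsub>?R\<^esub> \<otimes>\<^bsub>?R\<^esub> f) x = (\<Sum>y\<in>carrier G. if y = \<one> then f x else 0)"
            unfolding mult_nz[OF True] one by (rule sum.cong) (use True in auto)
          then show ?thesis using fin by simp
        qed (use f in \<open>simp add: mult_z car\<close>)
      qed
      show "f \<otimes>\<^bsub>?R\<^esub> \<one>\<^bsub>?R\<^esub> = f"
      proof
        fix x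
        show "(f \<otimes>\<^bsub>?R\<^esub> \<one>\<^bsub>?R\<^esub>) x = f x"
        proof (cases "x \<in> carrier G")
          case True
          have "(f \<otimes>\<^bsub>?R\<^esub> \<one>\<^bsub>?R\<^esub>) x = (\<Sum>y\<in>carrier G. if y = x then f y else 0)"
            unfolding mult_nz[OF True] one
          proof (rule sum.cong[OF refl])
            fix y assume y: "y \<in> carrier G"
            have "inv y \<otimes> x = \<one> \<longleftrightarrow> y = x"
              using True y by (metis inv_closed inv_equality inv_inv l_inv)
            then show "f y * indicator {\<one>} (inv y \<otimes> x) = (if y = x then f y else 0)"
              by (auto simp: indicator_def)
          qed
          then show ?thesis using True fin by simp
        qed (use f in \<open>simp add: mult_z car\<close>)
      qed
    qed
  next
    fix f g h
    show "(f \<oplus>\<^bsub>?R\<^esub> g) \<otimes>\<^bsub>?R\<^esub> h = f \<otimes>\<^bsub>?R\<^esub> h \<oplus>\<^bsub>?R\<^esub> g \<otimes>\<^bsub>?R\<^esub> h"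
      "h \<otimes>\<^bsub>?R\<^esub> (f \<oplus>\<^bsub>?R\<^esub> g) = h \<otimes>\<^bsub>?R\<^esub> f \<oplus>\<^bsub>?R\<^esub> h \<otimes>\<^bsub>?R\<^esub> g"
      by (auto simp: group_ring_def fun_eq_iff split_def sum.distrib distrib_left distrib_right)
  qed
qed

definition ring_center :: "('a, 'b) ring_scheme \<Rightarrow> 'a set" where
  "ring_center R = {z \<in> carrier R. \<forall>x\<in>carrier R. z \<otimes>\<^bsub>R\<^esub> x = x \<otimes>\<^bsub>R\<^esub> z}"


section \<open>S-rings\<close>

definition int_span :: "'a set set \<Rightarrow> ('a \<Rightarrow> int) set" where
  "int_span S = {\<lambda>x. \<Sum>X\<in>S. c X * indicator X x | c :: 'a set \<Rightarrow> int. True}"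

definition basic_partition ::
    "('a, 'b) monoid_scheme \<Rightarrow> ('a \<Rightarrow> int) set \<Rightarrow> 'a set set \<Rightarrow> bool" where
  "basic_partition G A S \<longleftrightarrow>
     partition_on (carrier G) S \<and>
     {\<one>\<^bsub>G\<^esub>} \<in> S \<and>
     (\<forall>X\<in>S. set_inv\<^bsub>G\<^esub> X \<in> S) \<and>
     A = int_span S"

definition S_ring :: "('a, 'b) monoid_scheme \<Rightarrow> ('a \<Rightarrow> int) set \<Rightarrow> bool" where
  "S_ring G A \<longleftrightarrow> subring A (group_ring G) \<and> (\<exists>S. basic_partition G A S)"

definition basic_sets :: "('a, 'b) monoid_scheme \<Rightarrow> ('a \<Rightarrow> int) set \<Rightarrow> 'a set set" where
  "basic_sets G A = (THE S. basic_partition G A S)"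

lemma int_span_const:
  assumes "disjoint S" "f \<in> int_span S" "Y \<in> S" "x \<in> Y" "y \<in> Y"
  shows "f x = f y"
proof -
  obtain c where f: "f = (\<lambda>x. \<Sum>X\<in>S. c X * indicator X x)"
    using assms(2) unfolding int_span_def by blast
  have "indicator X x = (indicator X y :: int)" if "X \<in> S" for X
  proof -
    have "X = Y \<or> X \<inter> Y = {}"
      using disjointD[OF assms(1) that assms(3)] by blast
    then show ?thesis using assms(4,5) by (auto simp: indicator_def)
  qed
  then show ?thesis unfolding f by simp
qed

lemma indicator_int_span:
  assumes "finite S" "X \<in> S"
  shows "indicator X \<in> int_span S"
proof -
  have "(\<Sum>Y\<in>S. (if Y = X then 1 else 0) * indicator Y x) = (indicator X x :: int)" for x
  proof -
    have "(\<Sum>Y\<in>S. (if Y = X then 1 else 0) * indicator Y x) =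
        (\<Sum>Y\<in>S. if Y = X then indicator X x else (0 :: int))"
      by (rule sum.cong) auto
    then show ?thesis using assms by simp
  qed
  then have "indicator X = (\<lambda>x. \<Sum>Y\<in>S. (if Y = X then 1 else 0) * (indicator Y x :: int))"
    by presburger
  then show ?thesis
    unfolding int_span_def by (intro CollectI exI[of _ "\<lambda>Y. if Y = X then 1 else 0"]) simp
qed

lemma basic_partition_unique:
  assumes fin: "finite (carrier G)" and S: "basic_partition G A S" and T: "basic_partition G A T"
  shows "S = T"
proof -
  have sub: "P \<subseteq> Q" if P: "basic_partition G A P" and Q: "basic_partition G A Q" for P Q
  proof
    fix X assume X: "X \<in> P"
    have pP: "partition_on (carrier G) P" and pQ: "partition_on (carrier G) Q"
      and eq: "int_span P = int_span Q"
      using P Q unfolding basic_partition_def by blast+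
    obtain x where x: "x \<in> X"
      using partition_onD3[OF pP] X by fastforce
    then have "x \<in> \<Union>Q"
      using partition_onD1[OF pP] partition_onD1[OF pQ] X by blast
    then obtain Y where Y: "Y \<in> Q" "x \<in> Y" by blast
    have iX: "(indicator X :: _ \<Rightarrow> int) \<in> int_span Q"
      using indicator_int_span[OF finite_elements[OF fin pP] X] eq by simp
    have iY: "(indicator Y :: _ \<Rightarrow> int) \<in> int_span P"
      using indicator_int_span[OF finite_elements[OF fin pQ] Y(1)] eq by simp
    have "Y \<subseteq> X"
    proof
      fix y assume "y \<in> Y"
      from int_span_const[OF partition_onD2[OF pQ] iX Y(1) Y(2) this] x
      show "y \<in> X" by (simp add: indicator_def split: if_splits)
    qed
    moreover have "X \<subseteq> Y"
    proof
      fix y assume "y \<in> X"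
      from int_span_const[OF partition_onD2[OF pP] iY X x this] Y(2)
      show "y \<in> Y" by (simp add: indicator_def split: if_splits)
    qed
    ultimately show "X \<in> Q" using Y(1) by simp
  qed
  show ?thesis using sub[OF S T] sub[OF T S] by (rule subset_antisym)
qed

lemma basic_sets_eq:
  assumes "finite (carrier G)" "basic_partition G A S"
  shows "basic_sets G A = S"
  unfolding basic_sets_def
proof (rule the_equality)
  show "basic_partition G A S" by fact
  show "T = S" if "basic_partition G A T" for T
    by (rule basic_partition_unique[OF assms(1) that assms(2)])
qed

definition schurian :: "('a, 'b) monoid_scheme \<Rightarrow> ('a \<Rightarrow> int) set \<Rightarrow> bool" where
  "schurian G A \<longleftrightarrow>
     (\<exists>K. subgroup K (BijGroup (carrier G)) \<and>
          (\<forall>g\<in>carrier G. (\<lambda>x\<in>carrier G. x \<otimes>\<^bsub>G\<^esub> g) \<in> K) \<and>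
          (let Sym_K = (BijGroup (carrier G))\<lparr>carrier := K\<rparr>;
               K\<^sub>e = stabilizer Sym_K (\<lambda>f. f) \<one>\<^bsub>G\<^esub>
           in basic_sets G A = orbits (Sym_K\<lparr>carrier := K\<^sub>e\<rparr>) (carrier G) (\<lambda>f. f)))"

definition central :: "('a, 'b) monoid_scheme \<Rightarrow> ('a \<Rightarrow> int) set \<Rightarrow> bool" where
  "central G A \<longleftrightarrow> A \<subseteq> ring_center (group_ring G)"

definition generalized_Schur :: "('a, 'b) monoid_scheme \<Rightarrow> bool" where
  "generalized_Schur G \<longleftrightarrow>
     group G \<and> finite (carrier G) \<and> (\<forall>A. S_ring G A \<and> central G A \<longrightarrow> schurian G A)"


section \<open>Camina pairs and Frobenius groups\<close>

definition conjugacy_class :: "('a, 'b) monoid_scheme \<Rightarrow> 'a \<Rightarrow> 'a set" where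
  "conjugacy_class G x = {g \<otimes>\<^bsub>G\<^esub> x \<otimes>\<^bsub>G\<^esub> inv\<^bsub>G\<^esub> g | g. g \<in> carrier G}"

definition Camina_pair :: "('a, 'b) monoid_scheme \<Rightarrow> 'a set \<Rightarrow> bool" where
  "Camina_pair G H \<longleftrightarrow>
     H \<lhd> G \<and> H \<noteq> carrier G \<and> H \<noteq> {\<one>\<^bsub>G\<^esub>} \<and>
     (\<forall>C\<in>rcosets\<^bsub>G\<^esub> H. C \<noteq> H \<longrightarrow> (\<exists>x\<in>carrier G. C \<subseteq> conjugacy_class G x))"

text \<open>
  A finite group is a Frobenius group if it has a Frobenius complement in the sense below.
  The kernel is a priori only a set; that it is a subgroup is Frobenius's theorem.
\<close>

definition Frobenius_complement :: "('a, 'b) monoid_scheme \<Rightarrow> 'a set \<Rightarrow> bool" where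
  "Frobenius_complement G K \<longleftrightarrow>
     subgroup K G \<and> K \<noteq> carrier G \<and> K \<noteq> {\<one>\<^bsub>G\<^esub>} \<and>
     (\<forall>g\<in>carrier G - K. K \<inter> (g <#\<^bsub>G\<^esub> K #>\<^bsub>G\<^esub> inv\<^bsub>G\<^esub> g) = {\<one>\<^bsub>G\<^esub>})"

definition Frobenius_kernel :: "('a, 'b) monoid_scheme \<Rightarrow> 'a set \<Rightarrow> 'a set" where
  "Frobenius_kernel G K =
     (carrier G - (\<Union>g\<in>carrier G. g <#\<^bsub>G\<^esub> K #>\<^bsub>G\<^esub> inv\<^bsub>G\<^esub> g)) \<union> {\<one>\<^bsub>G\<^esub>}"

end

theory Submission
  imports Defs
begin

text \<open>
  An S-ring is schurian iff any element of a basic set is mapped to any other by a permutation that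
  fixes the identity and preserves the basic set of \<open>b a\<inverse>\<close> for all \<open>a\<close> and \<open>b\<close>. If \<open>(G, H)\<close> is a
  Camina pair, every basic set \<open>X\<close> of a central S-ring over \<open>G\<close> has the property that \<open>X - H\<close> is a union
  of \<open>H\<close>-cosets. Hence the sets \<open>X \<inter> H\<close> form an S-ring over \<open>H\<close>, and \<open>H\<close> together with the images
  of the sets \<open>X - H\<close> form an S-ring over \<open>G/H\<close>. Both are central, hence schurian, and their
  automorphisms extend to \<open>G\<close>; this connects \<open>x\<close> and \<open>y\<close> if both lie in \<open>H\<close> or both lie outside.

  A basic set \<open>X\<close> meeting both \<open>H\<close> and its complement is unique and inverse-closed, as a comparison
  of structure constants shows. With \<open>U\<close> the union of the basic sets inside \<open>H\<close>, both \<open>U\<close> and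
  \<open>V = U \<union> X\<close> are subgroups, and all other basic sets outside \<open>H\<close> are invariant under multiplication
  by \<open>V\<close> on both sides. Therefore exchanging two \<open>U\<close>-cosets inside \<open>X\<close> is an automorphism.

  For a Frobenius group with kernel \<open>N\<close> and complement \<open>K\<close>, the hypothesis already makes \<open>N\<close> a group.
  Counting gives \<open>G = N K\<close>, and the \<open>N\<close>-conjugates of \<open>k \<noteq> 1\<close> in \<open>K\<close> are distinct and fill \<open>N k\<close>.
\<close>

section \<open>S-rings as equivalence relations\<close>

text \<open>The group ring product as a sum over one factor. At points of the carrier only values on
  the carrier enter, so the functions need not vanish outside it.\<close>

definition conv :: "('a, 'b) monoid_scheme \<Rightarrow> ('a \<Rightarrow> int) \<Rightarrow> ('a \<Rightarrow> int) \<Rightarrow> 'a \<Rightarrow> int" where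
  "conv G f g x = (\<Sum>y\<in>carrier G. f y * g (inv\<^bsub>G\<^esub> y \<otimes>\<^bsub>G\<^esub> x))"

text \<open>The classes of \<open>R\<close> are the basic sets; the S-ring consists of the functions respecting \<open>R\<close>.\<close>

locale schur_relation = group G for G (structure) +
  fixes R :: "('a \<times> 'a) set"
  assumes fin: "finite (carrier G)"
    and equiv: "equiv (carrier G) R"
    and class_one: "(\<one>, x) \<in> R \<Longrightarrow> x = \<one>"
    and inv_related: "(x, y) \<in> R \<Longrightarrow> (inv x, inv y) \<in> R"
    and conv_respects: "f respects R \<Longrightarrow> g respects R \<Longrightarrow> conv G f g respects R"

definition central_relation :: "('a, 'b) monoid_scheme \<Rightarrow> ('a \<times> 'a) set \<Rightarrow> bool" where
  "central_relation G R \<longleftrightarrow>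
     (\<forall>x\<in>carrier G. \<forall>g\<in>carrier G. (x, g \<otimes>\<^bsub>G\<^esub> x \<otimes>\<^bsub>G\<^esub> inv\<^bsub>G\<^esub> g) \<in> R)"

text \<open>These are the automorphisms of the Cayley scheme in which the arc from \<open>a\<close>
  to \<open>b\<close> is coloured by the class of \<open>b a\<inverse>\<close>. The inverse stands
  on the right so that right translations preserve the colours.\<close>

definition relation_aut :: "('a, 'b) monoid_scheme \<Rightarrow> ('a \<times> 'a) set \<Rightarrow> ('a \<Rightarrow> 'a) \<Rightarrow> bool" where
  "relation_aut G R f \<longleftrightarrow> bij_betw f (carrier G) (carrier G) \<and>
     (\<forall>a\<in>carrier G. \<forall>b\<in>carrier G. (b \<otimes>\<^bsub>G\<^esub> inv\<^bsub>G\<^esub> a, f b \<otimes>\<^bsub>G\<^esub> inv\<^bsub>G\<^esub> f a) \<in> R)"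

text \<open>Only transitivity on each class is demanded: an automorphism fixing the identity maps
  each class to itself, as the case \<open>a = \<one>\<close> of \<open>relation_aut\<close>
  shows.\<close>

definition schurian_relation :: "('a, 'b) monoid_scheme \<Rightarrow> ('a \<times> 'a) set \<Rightarrow> bool" where
  "schurian_relation G R \<longleftrightarrow>
     (\<forall>x y. (x, y) \<in> R \<longrightarrow> (\<exists>f. relation_aut G R f \<and> f \<one>\<^bsub>G\<^esub> = \<one>\<^bsub>G\<^esub> \<and> f x = y))"

section \<open>Dictionary between S-rings and equivalence relations\<close>

lemma group_ring_mult:
  assumes "group G" and x: "x \<in> carrier G"
  shows "(f \<otimes>\<^bsub>group_ring G\<^esub> g) x = conv G f g x"
proof -
  interpret group G by fact
  have "{(y, z) \<in> carrier G \<times> carrier G. y \<otimes>\<^bsub>G\<^esub> z = x} = (\<lambda>y. (y, inv\<^bsub>G\<^esub> y \<otimes>\<^bsub>G\<^esub> x)) ` carrier G"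
    using x inv_solve_left by (force simp flip: m_assoc)
  moreover have "inj_on (\<lambda>y. (y, inv\<^bsub>G\<^esub> y \<otimes>\<^bsub>G\<^esub> x)) (carrier G)"
    by (auto simp: inj_on_def)
  ultimately show ?thesis
    by (simp add: group_ring_def sum.reindex conv_def)
qed

lemma group_ring_mult_outside:
  assumes "group G" "x \<notin> carrier G"
  shows "(f \<otimes>\<^bsub>group_ring G\<^esub> g) x = 0"
proof -
  interpret group G by fact
  have "{(y, z) \<in> carrier G \<times> carrier G. y \<otimes>\<^bsub>G\<^esub> z = x} = {}"
    using assms(2) by auto
  then show ?thesis by (simp only: group_ring_def monoid.simps sum.empty)
qed

text \<open>A function constant on classes is the combination of their indicators whose coefficients
  are its values at arbitrary representatives. Membership in the S-ring thereby becomes a pointwise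
  condition.\<close>

lemma int_span_quotient:
  assumes E: "equiv A R" and fin: "finite A"
  shows "int_span (A // R) = {f. (\<forall>x. x \<notin> A \<longrightarrow> f x = 0) \<and> f respects R}"
proof (intro equalityI subsetI)
  fix f assume f: "f \<in> int_span (A // R)"
  then obtain c where c: "f = (\<lambda>x. \<Sum>X\<in>A // R. c X * indicator X x)"
    unfolding int_span_def by blast
  have "f x = 0" if "x \<notin> A" for x
    using that in_quotient_imp_subset[OF E]
    unfolding c by (intro sum.neutral) (auto simp: indicator_def)
  moreover have "f respects R"
  proof (rule congruentI)
    fix x y assume xy: "(x, y) \<in> R"
    then have "x \<in> A" using E by (meson equiv_class_eq_iff)
    then have "R `` {x} \<in> A // R" "x \<in> R `` {x}" "y \<in> R `` {x}"
      using xy equiv_class_self[OF E] by (auto intro: quotientI)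
    with int_span_const[OF partition_onD2[OF partition_on_quotient[OF E]] f]
    show "f x = f y" by blast
  qed
  ultimately show "f \<in> {f. (\<forall>x. x \<notin> A \<longrightarrow> f x = 0) \<and> f respects R}" by blast
next
  fix f :: "_ \<Rightarrow> int" assume "f \<in> {f. (\<forall>x. x \<notin> A \<longrightarrow> f x = 0) \<and> f respects R}"
  then have f0: "\<And>x. x \<notin> A \<Longrightarrow> f x = 0" and fR: "f respects R" by auto
  define c where "c X = f (SOME x. x \<in> X)" for X
  have fq: "finite (A // R)"
    using E fin by (metis equiv_type finite_quotient)
  have "f x = (\<Sum>X\<in>A // R. c X * indicator X x)" for x
  proof (cases "x \<in> A")
    case True
    let ?C = "R `` {x}"
    have C: "?C \<in> A // R" "x \<in> ?C"
      using True equiv_class_self[OF E True] by (simp_all add: quotientI)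
    have "(SOME y. y \<in> ?C) \<in> ?C" using C(2) by (rule someI)
    then have cf: "c ?C = f x"
      unfolding c_def using fR by (metis Image_singleton_iff congruentD)
    have "(\<Sum>X\<in>A // R. c X * indicator X x) = (\<Sum>X\<in>A // R. if X = ?C then f x else 0)"
    proof (rule sum.cong[OF refl])
      fix X assume X: "X \<in> A // R"
      show "c X * indicator X x = (if X = ?C then f x else 0)"
      proof (cases "X = ?C")
        case False
        then have "x \<notin> X" using quotient_disj[OF E X C(1)] C(2) by blast
        then show ?thesis using False by simp
      qed (use cf C in \<open>simp add: indicator_def\<close>)
    qed
    then show ?thesis using fq C(1) by simp
  next
    case False
    then have "(\<Sum>X\<in>A // R. c X * indicator X x) = 0"
      using in_quotient_imp_subset[OF E] by (intro sum.neutral) (auto simp: indicator_def)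
    then show ?thesis using f0 False by simp
  qed
  then show "f \<in> int_span (A // R)"
    unfolding int_span_def by blast
qed

lemma set_inv_mem: "x \<in> X \<Longrightarrow> inv\<^bsub>G\<^esub> x \<in> set_inv\<^bsub>G\<^esub> X"
  by (auto simp: SET_INV_def)

lemma respects_outside:
  assumes "equiv A R" "f respects R"
  shows "(\<lambda>x. if x \<in> A then f x else 0) respects R"
  using assms by (auto simp: congruent_def equiv_class_eq_iff)

lemma conv_cong:
  assumes "group G" "\<And>x. x \<in> carrier G \<Longrightarrow> f x = f' x" "\<And>x. x \<in> carrier G \<Longrightarrow> g x = g' x" "x \<in> carrier G"
  shows "conv G f g x = conv G f' g' x"
  unfolding conv_def using assms
  by (intro sum.cong) (auto simp: group.inv_closed group.is_monoid monoid.m_closed)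

lemma (in group) inv_mult_cancel:
  assumes "x \<in> carrier G" "y \<in> carrier G"
  shows "inv x \<otimes> (x \<otimes> y) = y" "x \<otimes> (inv x \<otimes> y) = y"
  using assms by (simp_all flip: m_assoc)

text \<open>The substitution \<open>y = x \<otimes> inv w\<close> exchanges the two factors, except
  that \<open>f\<close> is evaluated at \<open>x \<otimes> inv w\<close> instead of its conjugate
  \<open>inv w \<otimes> x\<close>.\<close>

lemma (in group) conv_commute:
  assumes f: "\<And>y x. x \<in> carrier G \<Longrightarrow> y \<in> carrier G \<Longrightarrow> f (y \<otimes> x \<otimes> inv y) = f x"
    and x: "x \<in> carrier G"
  shows "conv G f g x = conv G g f x"
proof -
  have bij: "bij_betw (\<lambda>w. x \<otimes> inv w) (carrier G) (carrier G)"
    by (rule bij_betw_byWitness[where f' = "\<lambda>y. inv y \<otimes> x"])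
      (use x in \<open>auto simp: inv_mult_group m_assoc inv_mult_cancel\<close>)
  have "conv G f g x = (\<Sum>w\<in>carrier G. f (x \<otimes> inv w) * g (inv (x \<otimes> inv w) \<otimes> x))"
    unfolding conv_def by (rule sum.reindex_bij_betw[OF bij, symmetric])
  also have "\<dots> = conv G g f x"
    unfolding conv_def
  proof (rule sum.cong[OF refl])
    fix w assume w: "w \<in> carrier G"
    have "w \<otimes> (inv w \<otimes> x) \<otimes> inv w = x \<otimes> inv w"
      using x w by (simp flip: m_assoc)
    then have "f (x \<otimes> inv w) = f (inv w \<otimes> x)"
      using f[of "inv w \<otimes> x" w] x w by simp
    moreover have "inv (x \<otimes> inv w) \<otimes> x = w"
      using x w by (simp add: inv_mult_group m_assoc)
    ultimately show "f (x \<otimes> inv w) * g (inv (x \<otimes> inv w) \<otimes> x) = g w * f (inv w \<otimes> x)"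
      by simp
  qed
  finally show ?thesis .
qed

lemma (in schur_relation)
  assumes "(x, y) \<in> R"
  shows related_carrier: "x \<in> carrier G" "y \<in> carrier G"
    and related_sym: "(y, x) \<in> R"
  using assms equiv by (auto simp: equiv_def sym_def)

lemma (in schur_relation) related_refl: "x \<in> carrier G \<Longrightarrow> (x, x) \<in> R"
  using equiv by (simp add: equiv_def refl_on_def)

lemma (in schur_relation) related_trans: "(x, y) \<in> R \<Longrightarrow> (y, z) \<in> R \<Longrightarrow> (x, z) \<in> R"
  using equiv by (auto simp: equiv_def dest: transD)

lemma (in schur_relation) indicator_respects: "(indicator (R `` {x}) :: 'a \<Rightarrow> int) respects R"
  by (auto simp: congruent_def indicator_def intro: related_trans related_sym)

text \<open>The axioms of the locale are the closure conditions in another form: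
  \<open>class_one\<close> and \<open>inv_related\<close> concern the partition,
  \<open>conv_respects\<close> the product. Uniqueness of the basic partition then identifies the
  basic sets.\<close>

lemma (in schur_relation) S_ring_int_span: "S_ring G (int_span (carrier G // R))"
  and basic_sets_int_span: "basic_sets G (int_span (carrier G // R)) = carrier G // R"
proof -
  let ?A = "int_span (carrier G // R)" and ?Z = "group_ring G"
  have span: "f \<in> ?A \<longleftrightarrow> (\<forall>x. x \<notin> carrier G \<longrightarrow> f x = 0) \<and> f respects R" for f
    using int_span_quotient[OF equiv fin] by simp
  interpret Z: ring ?Z
    by (rule group_ring_ring[OF is_group fin])
  have "subring ?A ?Z"
  proof (rule Z.subringI)
    show sub: "?A \<subseteq> carrier ?Z"
      by (auto simp: span group_ring_def)
    show "\<one>\<^bsub>?Z\<^esub> \<in> ?A"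
      using class_one related_sym
      by (auto simp: span group_ring_def congruent_def indicator_def)
    fix f assume f: "f \<in> ?A"
    have "(\<lambda>x. - f x) \<in> ?A"
      using f by (simp add: span congruent_def)
    moreover have "\<ominus>\<^bsub>?Z\<^esub> f = (\<lambda>x. - f x)"
      using f calculation sub by (intro Z.minus_equality) (auto simp: group_ring_def)
    ultimately show "\<ominus>\<^bsub>?Z\<^esub> f \<in> ?A" by simp
    fix g assume g: "g \<in> ?A"
    show "f \<oplus>\<^bsub>?Z\<^esub> g \<in> ?A"
      using f g by (fastforce simp: span group_ring_def congruent_def)
    have "(f \<otimes>\<^bsub>?Z\<^esub> g) respects R"
      using conv_respects[of f g] f g
      by (auto simp: span congruent_def group_ring_mult[OF is_group] related_carrier)
    then show "f \<otimes>\<^bsub>?Z\<^esub> g \<in> ?A"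
      by (simp add: span group_ring_mult_outside[OF is_group])
  qed
  moreover have bp: "basic_partition G ?A (carrier G // R)"
    unfolding basic_partition_def
  proof (intro conjI ballI)
    show "partition_on (carrier G) (carrier G // R)"
      by (rule partition_on_quotient[OF equiv])
    have "R `` {\<one>} = {\<one>}"
      using class_one equiv_class_self[OF equiv] by auto
    then show "{\<one>} \<in> carrier G // R"
      using quotientI[of \<one> "carrier G" R] by simp
    fix X assume "X \<in> carrier G // R"
    then obtain x where x: "x \<in> carrier G" "X = R `` {x}"
      by (rule quotientE)
    have "set_inv X = R `` {inv x}"
    proof (intro equalityI subsetI)
      fix y assume y: "y \<in> R `` {inv x}"
      then have "(x, inv y) \<in> R"
        using inv_related[of "inv x" y] x by simp
      then show "y \<in> set_inv X"
        using y x related_carrier by (force simp: SET_INV_def)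
    qed (use x inv_related in \<open>auto simp: SET_INV_def\<close>)
    then show "set_inv X \<in> carrier G // R"
      using x by (simp add: quotientI)
  qed simp
  ultimately show "S_ring G ?A"
    unfolding S_ring_def by blast
  show "basic_sets G ?A = carrier G // R"
    by (rule basic_sets_eq[OF fin bp])
qed

lemma S_ring_imp_schur_relation:
  assumes "group G" and fin: "finite (carrier G)" and A: "S_ring G A"
  obtains R where "schur_relation G R" "A = int_span (carrier G // R)"
proof -
  interpret group G by fact
  obtain S where sub: "subring A (group_ring G)" and S: "basic_partition G A S"
    using A unfolding S_ring_def by blast
  have part: "partition_on (carrier G) S" and one: "{\<one>\<^bsub>G\<^esub>} \<in> S"
    and inv: "\<And>X. X \<in> S \<Longrightarrow> set_inv\<^bsub>G\<^esub> X \<in> S" and span: "A = int_span S"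
    using S unfolding basic_partition_def by blast+
  define R where "R = {(x, y). \<exists>X\<in>S. x \<in> X \<and> y \<in> X}"
  have E: "equiv (carrier G) R"
    unfolding R_def by (rule equiv_partition_on[OF part])
  have A_eq: "A = int_span (carrier G // R)"
    unfolding span R_def partition_on_eq_quotient[OF part] ..
  then have A_iff: "f \<in> A \<longleftrightarrow> (\<forall>x. x \<notin> carrier G \<longrightarrow> f x = 0) \<and> f respects R" for f
    using int_span_quotient[OF E fin] by simp
  have R_carrier: "x \<in> carrier G" "y \<in> carrier G" if "(x, y) \<in> R" for x y
    using that E by (meson equiv_class_eq_iff)+
  have "schur_relation G R"
  proof
    fix x assume "(\<one>\<^bsub>G\<^esub>, x) \<in> R"
    then show "x = \<one>\<^bsub>G\<^esub>"
      using one partition_onD2[OF part] unfolding R_def by (fastforce dest: disjointD)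
  next
    fix x y assume "(x, y) \<in> R"
    then obtain X where "X \<in> S" "x \<in> X" "y \<in> X" unfolding R_def by blast
    then show "(inv\<^bsub>G\<^esub> x, inv\<^bsub>G\<^esub> y) \<in> R"
      using inv[of X] unfolding R_def by (blast intro: set_inv_mem)
  next
    fix f g :: "'a \<Rightarrow> int" assume f: "f respects R" and g: "g respects R"
    \<comment> \<open>The locale speaks of all functions respecting \<open>R\<close>, the S-ring
      only of those vanishing outside the carrier; truncation does not change the convolution on the
      carrier.\<close>
    let ?f = "\<lambda>x. if x \<in> carrier G then f x else 0"
    let ?g = "\<lambda>x. if x \<in> carrier G then g x else 0"
    have "?f \<in> A" "?g \<in> A"
      using respects_outside[OF E f] respects_outside[OF E g] by (simp_all add: A_iff)
    then have "?f \<otimes>\<^bsub>group_ring G\<^esub> ?g \<in> A"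
      by (rule subringE(6)[OF sub])
    then have 1: "(?f \<otimes>\<^bsub>group_ring G\<^esub> ?g) respects R"
      by (simp add: A_iff)
    have 2: "(?f \<otimes>\<^bsub>group_ring G\<^esub> ?g) x = conv G f g x" if "x \<in> carrier G" for x
      unfolding group_ring_mult[OF is_group that] by (rule conv_cong[OF is_group _ _ that]) simp_all
    show "conv G f g respects R"
      using 1 by (auto simp: congruent_def 2 R_carrier)
  qed (fact fin, fact E)
  with A_eq that show thesis by blast
qed

text \<open>Let the indicator of the class of \<open>x\<close> commute with the group element
  \<open>g\<close> and compare coefficients at \<open>g \<otimes> x\<close>. One order of the
  product evaluates the indicator at \<open>x\<close>, the other at the conjugate of
  \<open>x\<close> by \<open>g\<close>. The converse is \<open>conv_commute\<close>.\<close>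

lemma (in schur_relation) central_int_span:
  "central G (int_span (carrier G // R)) \<longleftrightarrow> central_relation G R"
proof
  let ?A = "int_span (carrier G // R)"
  have A: "?A = {f. (\<forall>x. x \<notin> carrier G \<longrightarrow> f x = 0) \<and> f respects R}"
    by (rule int_span_quotient[OF equiv fin])
  show "central_relation G R" if c: "central G ?A"
    unfolding central_relation_def
  proof (intro ballI)
    fix x g assume x: "x \<in> carrier G" and g: "g \<in> carrier G"
    let ?f = "indicator (R `` {x}) :: 'a \<Rightarrow> int" and ?g = "indicator {g} :: 'a \<Rightarrow> int"
    let ?z = "g \<otimes> x"
    have "?f \<in> ?A"
      using indicator_respects[of x] related_carrier(2)[of x] by (auto simp: A indicator_def)
    moreover have "?g \<in> carrier (group_ring G)"
      using g by (auto simp: group_ring_def indicator_def)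
    ultimately have "?f \<otimes>\<^bsub>group_ring G\<^esub> ?g = ?g \<otimes>\<^bsub>group_ring G\<^esub> ?f"
      using c unfolding central_def ring_center_def by blast
    then have "conv G ?f ?g ?z = conv G ?g ?f ?z"
      using x g by (metis group_ring_mult is_group m_closed)
    moreover have "conv G ?g ?f ?z = 1"
    proof -
      have "conv G ?g ?f ?z = (\<Sum>y\<in>carrier G. if y = g then 1 else 0)"
        unfolding conv_def using x g equiv_class_self[OF equiv]
        by (intro sum.cong) (auto simp: inv_mult_cancel)
      then show ?thesis using g fin by simp
    qed
    moreover have "conv G ?f ?g ?z = ?f (g \<otimes> x \<otimes> inv g)"
    proof -
      have "inv y \<otimes> ?z = g \<longleftrightarrow> y = g \<otimes> x \<otimes> inv g" if "y \<in> carrier G" for y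
      proof
        assume "inv y \<otimes> ?z = g"
        then have "?z = y \<otimes> g"
          using that x g by (metis inv_mult_cancel(2) m_closed)
        then show "y = g \<otimes> x \<otimes> inv g"
          using that x g by (simp add: m_assoc)
      qed (use x g in \<open>simp add: inv_mult_group m_assoc inv_mult_cancel\<close>)
      then have "conv G ?f ?g ?z =
          (\<Sum>y\<in>carrier G. if y = g \<otimes> x \<otimes> inv g then ?f (g \<otimes> x \<otimes> inv g) else 0)"
        unfolding conv_def by (intro sum.cong) (auto simp: indicator_def)
      then show ?thesis using x g fin by simp
    qed
    ultimately show "(x, g \<otimes> x \<otimes> inv g) \<in> R"
      by (auto simp: indicator_def split: if_splits)
  qed
  show "central G ?A" if c: "central_relation G R"
    unfolding central_def ring_center_def
  proof (intro subsetI CollectI conjI ballI)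
    fix f assume f: "f \<in> ?A"
    then show "f \<in> carrier (group_ring G)" by (simp add: A group_ring_def)
    have fR: "f respects R" using f by (simp add: A)
    have "f (y \<otimes> x \<otimes> inv y) = f x"
      if "x \<in> carrier G" "y \<in> carrier G" for x y
      using that c congruentD[OF fR, of x "y \<otimes> x \<otimes> inv y"] unfolding central_relation_def by simp
    then have comm: "conv G f g x = conv G g f x" if "x \<in> carrier G" for x g
      using that by (rule conv_commute)
    show "f \<otimes>\<^bsub>group_ring G\<^esub> g = g \<otimes>\<^bsub>group_ring G\<^esub> f" for g
    proof
      fix x
      show "(f \<otimes>\<^bsub>group_ring G\<^esub> g) x = (g \<otimes>\<^bsub>group_ring G\<^esub> f) x"
        by (cases "x \<in> carrier G")
          (simp_all add: comm group_ring_mult[OF is_group] group_ring_mult_outside[OF is_group])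
    qed
  qed
qed

section \<open>Automorphisms of a relation and the schurian property\<close>

lemma (in schur_relation) relation_autD:
  assumes "relation_aut G R f"
  shows "x \<in> carrier G \<Longrightarrow> f x \<in> carrier G"
    and "bij_betw f (carrier G) (carrier G)"
    and "a \<in> carrier G \<Longrightarrow> b \<in> carrier G \<Longrightarrow> (b \<otimes> inv a, f b \<otimes> inv (f a)) \<in> R"
  using assms by (auto simp: relation_aut_def dest: bij_betwE)

lemma (in schur_relation) relation_aut_comp:
  assumes f: "relation_aut G R f" and g: "relation_aut G R g"
  shows "relation_aut G R (g \<circ> f)"
  unfolding relation_aut_def
proof (intro conjI ballI)
  show "bij_betw (g \<circ> f) (carrier G) (carrier G)"
    using f g by (auto simp: relation_aut_def intro: bij_betw_trans)
  fix a b assume "a \<in> carrier G" "b \<in> carrier G"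
  then show "(b \<otimes> inv a, (g \<circ> f) b \<otimes> inv ((g \<circ> f) a)) \<in> R"
    using related_trans[OF relation_autD(3)[OF f] relation_autD(3)[OF g]] relation_autD(1)[OF f]
    by simp
qed

lemma (in schur_relation) relation_aut_inv:
  assumes f: "relation_aut G R f"
  shows "relation_aut G R (inv_into (carrier G) f)"
  unfolding relation_aut_def
proof (intro conjI ballI)
  let ?g = "inv_into (carrier G) f"
  note bij = relation_autD(2)[OF f]
  show "bij_betw ?g (carrier G) (carrier G)"
    by (rule bij_betw_inv_into[OF bij])
  fix a b assume "a \<in> carrier G" "b \<in> carrier G"
  moreover from this have "?g a \<in> carrier G" "?g b \<in> carrier G"
    using bij by (metis bij_betw_def inv_into_into)+
  ultimately show "(b \<otimes> inv a, ?g b \<otimes> inv (?g a)) \<in> R"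
    using relation_autD(3)[OF f, of "?g a" "?g b"] bij
    by (simp add: bij_betw_inv_into_right related_sym)
qed

lemma relation_aut_cong:
  assumes "group G" "\<And>x. x \<in> carrier G \<Longrightarrow> f x = g x"
  shows "relation_aut G R f \<longleftrightarrow> relation_aut G R g"
  unfolding relation_aut_def using assms bij_betw_cong[of "carrier G" f g] by simp

lemma (in schur_relation) relation_aut_right_mult:
  assumes g: "g \<in> carrier G"
  shows "relation_aut G R (\<lambda>x. x \<otimes> g)"
  unfolding relation_aut_def
proof (intro conjI ballI)
  show "bij_betw (\<lambda>x. x \<otimes> g) (carrier G) (carrier G)"
    by (rule bij_betw_byWitness[where f' = "\<lambda>x. x \<otimes> inv g"]) (use g in \<open>auto simp: m_assoc\<close>)
  fix a b assume ab: "a \<in> carrier G" "b \<in> carrier G"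
  then have "b \<otimes> g \<otimes> inv (a \<otimes> g) = b \<otimes> inv a"
    using g by (simp add: inv_mult_group m_assoc inv_mult_cancel)
  then show "(b \<otimes> inv a, b \<otimes> g \<otimes> inv (a \<otimes> g)) \<in> R"
    using ab by (simp add: related_refl)
qed

text \<open>A witness \<open>K\<close> consists of automorphisms, because right translations reduce
  a pair of points to a pair containing the identity. Conversely, the group of all automorphisms is
  itself a witness.\<close>

lemma (in schur_relation) schurian_int_span:
  "schurian G (int_span (carrier G // R)) \<longleftrightarrow> schurian_relation G R"
proof
  let ?B = "BijGroup (carrier G)"
  have orb: "orbits (?B\<lparr>carrier := K, carrier := stabilizer (?B\<lparr>carrier := K\<rparr>) (\<lambda>f. f) \<one>\<rparr>) (carrier G) (\<lambda>f. f) =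
     {{f x | f. f \<in> K \<and> f \<one> = \<one>} | x. x \<in> carrier G}" for K
    by (simp add: orbits_def orbit_def stabilizer_def)
  show "schurian_relation G R" if s: "schurian G (int_span (carrier G // R))"
  proof -
    obtain K where K: "subgroup K ?B"
      and trans: "\<And>g. g \<in> carrier G \<Longrightarrow> (\<lambda>x\<in>carrier G. x \<otimes> g) \<in> K"
      and orbs: "carrier G // R = {{f x | f. f \<in> K \<and> f \<one> = \<one>} | x. x \<in> carrier G}"
      using s unfolding schurian_def basic_sets_int_span Let_def orb by blast
    have K_Bij: "K \<subseteq> Bij (carrier G)"
      using subgroup.subset[OF K] by (simp add: BijGroup_def)
    have K_comp: "compose (carrier G) f g \<in> K" if "f \<in> K" "g \<in> K" for f g
      using subgroup.m_closed[OF K that] subsetD[OF K_Bij that(1)] subsetD[OF K_Bij that(2)]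
      by (simp add: BijGroup_def)
    have K_id: "(\<lambda>x\<in>carrier G. x) \<in> K"
      using subgroup.one_closed[OF K] by (simp add: BijGroup_def)
    have stab: "(x, f x) \<in> R" if "f \<in> K" "f \<one> = \<one>" "x \<in> carrier G" for f x
    proof -
      let ?O = "{f x | f. f \<in> K \<and> f \<one> = \<one>}"
      have O: "?O \<in> carrier G // R" unfolding orbs using that(3) by blast
      have fx: "f x \<in> ?O" using that(1,2) by (intro CollectI exI[of _ f] conjI refl)
      have x: "x \<in> ?O"
        using K_id that(3) by (intro CollectI exI[of _ "\<lambda>x\<in>carrier G. x"]) simp
      show ?thesis
        by (rule iffD1[OF quotient_eq_iff[OF equiv O O x fx] refl])
    qed
    have aut: "relation_aut G R f" if f: "f \<in> K" for f
      unfolding relation_aut_def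
    proof (intro conjI ballI)
      show "bij_betw f (carrier G) (carrier G)"
        using f K_Bij by (auto simp: Bij_def)
      then have fc: "f x \<in> carrier G" if "x \<in> carrier G" for x
        using that by (auto dest: bij_betwE)
      fix a b assume ab: "a \<in> carrier G" "b \<in> carrier G"
      \<comment> \<open>Right translations take the identity to \<open>a\<close> before
        \<open>f\<close> and \<open>f a\<close> to the identity after it. So \<open>?h\<close> lies
        in the stabilizer, and it sends \<open>b \<otimes> inv a\<close> to
        \<open>f b \<otimes> inv (f a)\<close>.\<close>
      let ?h = "compose (carrier G) (\<lambda>x\<in>carrier G. x \<otimes> inv (f a))
         (compose (carrier G) f (\<lambda>x\<in>carrier G. x \<otimes> a))"
      have "?h \<in> K"
        using ab fc f by (intro K_comp trans) auto
      moreover have "?h x = f (x \<otimes> a) \<otimes> inv (f a)" if "x \<in> carrier G" for x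
        using that ab fc by (simp add: compose_def)
      ultimately show "(b \<otimes> inv a, f b \<otimes> inv (f a)) \<in> R"
        using stab[of ?h "b \<otimes> inv a"] ab fc by (simp add: m_assoc)
    qed
    show ?thesis
      unfolding schurian_relation_def
    proof clarify
      fix x y assume xy: "(x, y) \<in> R"
      then have "R `` {x} \<in> carrier G // R" by (simp add: quotientI related_carrier)
      then obtain z where z: "z \<in> carrier G" "R `` {x} = {f z | f. f \<in> K \<and> f \<one> = \<one>}"
        unfolding orbs by blast
      have "x \<in> R `` {x}" "y \<in> R `` {x}"
        using xy related_refl[OF related_carrier(1)[OF xy]] by auto
      then obtain f g where fg: "f \<in> K" "f \<one> = \<one>" "x = f z" "g \<in> K" "g \<one> = \<one>" "y = g z"
        unfolding z(2) by blast
      \<comment> \<open>Back from \<open>x\<close> to the common orbit point \<open>z\<close>, then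
        forward to \<open>y\<close>.\<close>
      let ?h = "g \<circ> inv_into (carrier G) f"
      have inj: "inj_on f (carrier G)"
        using aut[OF fg(1)] by (auto simp: relation_aut_def bij_betw_def)
      have "inv_into (carrier G) f x = z" "inv_into (carrier G) f \<one> = \<one>"
        using inv_into_f_f[OF inj z(1)] inv_into_f_f[OF inj one_closed] by (simp_all add: fg(2,3))
      then have "?h \<one> = \<one>" "?h x = y" by (simp_all add: fg(5,6))
      moreover have "relation_aut G R ?h"
        by (intro relation_aut_comp relation_aut_inv aut fg)
      ultimately show "\<exists>f. relation_aut G R f \<and> f \<one> = \<one> \<and> f x = y"
        by (intro exI[of _ ?h] conjI)
    qed
  qed
  show "schurian G (int_span (carrier G // R))" if s: "schurian_relation G R"
  proof -
    \<comment> \<open>The elements of \<open>Bij\<close> are extensional, so automorphisms enter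
      \<open>K\<close> only after restriction to the carrier.\<close>
    define K where "K = {f \<in> Bij (carrier G). relation_aut G R f}"
    have restrict_K: "restrict f (carrier G) \<in> K" if "relation_aut G R f" for f
    proof -
      have "relation_aut G R (restrict f (carrier G))"
        by (rule iffD1[OF relation_aut_cong[OF is_group] that]) simp
      then show ?thesis
        by (simp add: K_def Bij_def relation_autD(2)[OF that])
    qed
    have "subgroup K ?B"
    proof (rule group.subgroupI[OF group_BijGroup])
      show "K \<subseteq> carrier ?B" by (auto simp: K_def BijGroup_def)
      show "K \<noteq> {}" using restrict_K[OF relation_aut_right_mult[OF one_closed]] by blast
      show "inv\<^bsub>?B\<^esub> f \<in> K" if "f \<in> K" for f
        using that restrict_K[OF relation_aut_inv, of f] by (simp add: K_def inv_BijGroup)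
      show "f \<otimes>\<^bsub>?B\<^esub> g \<in> K" if "f \<in> K" "g \<in> K" for f g
        using that restrict_K[OF relation_aut_comp, of g f]
        by (simp add: K_def BijGroup_def compose_def comp_def)
    qed
    moreover have "\<forall>g\<in>carrier G. (\<lambda>x\<in>carrier G. x \<otimes> g) \<in> K"
      using restrict_K[OF relation_aut_right_mult] by blast
    moreover have "carrier G // R = {{f x | f. f \<in> K \<and> f \<one> = \<one>} | x. x \<in> carrier G}"
    proof -
      have "R `` {x} = {f x | f. f \<in> K \<and> f \<one> = \<one>}" if x: "x \<in> carrier G" for x
      proof (intro equalityI subsetI)
        fix y assume "y \<in> R `` {x}"
        then obtain f where f: "relation_aut G R f" "f \<one> = \<one>" "f x = y"
          using s unfolding schurian_relation_def by blast
        show "y \<in> {f x | f. f \<in> K \<and> f \<one> = \<one>}"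
          by (intro CollectI exI[of _ "restrict f (carrier G)"]) (use f x restrict_K in auto)
      next
        fix y assume "y \<in> {f x | f. f \<in> K \<and> f \<one> = \<one>}"
        then obtain f where "relation_aut G R f" "f \<one> = \<one>" "y = f x"
          by (auto simp: K_def)
        then show "y \<in> R `` {x}"
          using relation_autD(3)[of f \<one> x] relation_autD(1)[of f x] x by simp
      qed
      then show ?thesis unfolding quotient_def by blast
    qed
    ultimately show ?thesis
      unfolding schurian_def basic_sets_int_span Let_def orb by blast
  qed
qed

text \<open>Completes the dictionary; the argument below works with relations and
  convolutions.\<close>

lemma generalized_Schur_iff:
  assumes "group G" "finite (carrier G)"
  shows "generalized_Schur G \<longleftrightarrow>
    (\<forall>R. schur_relation G R \<and> central_relation G R \<longrightarrow> schurian_relation G R)"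
proof
  show "\<forall>R. schur_relation G R \<and> central_relation G R \<longrightarrow> schurian_relation G R"
    if "generalized_Schur G"
  proof (intro allI impI)
    fix R assume R: "schur_relation G R \<and> central_relation G R"
    then interpret schur_relation G R by simp
    show "schurian_relation G R"
      using R that S_ring_int_span central_int_span schurian_int_span
      by (simp add: generalized_Schur_def)
  qed
  show "generalized_Schur G"
    if R: "\<forall>R. schur_relation G R \<and> central_relation G R \<longrightarrow> schurian_relation G R"
    unfolding generalized_Schur_def
  proof (intro conjI allI impI)
    fix A assume A: "S_ring G A \<and> central G A"
    then obtain S where S: "schur_relation G S" and A_eq: "A = int_span (carrier G // S)"
      using S_ring_imp_schur_relation[OF assms] by metis
    interpret schur_relation G S by fact
    show "schurian G A"
      using A R S central_int_span schurian_int_span by (simp add: A_eq)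
  qed (fact assms)+
qed

section \<open>Restriction to the subgroup and passage to the quotient\<close>

text \<open>The axiom \<open>fused\<close> is what the Camina condition and centrality yield
  together, see \<open>Camina_pair_fused\<close>.\<close>

locale fused_relation = schur_relation G R + normal H G
  for G (structure) and R H +
  assumes fused: "x \<in> carrier G \<Longrightarrow> x \<notin> H \<Longrightarrow> h \<in> H \<Longrightarrow> (x, h \<otimes> x) \<in> R"
begin

lemma H_mult_iff:
  assumes "x \<in> carrier G" "h \<in> H"
  shows "h \<otimes> x \<in> H \<longleftrightarrow> x \<in> H" "x \<otimes> h \<in> H \<longleftrightarrow> x \<in> H"
proof -
  have h: "h \<in> carrier G" using assms by simp
  have "x = inv h \<otimes> (h \<otimes> x)" "x = (x \<otimes> h) \<otimes> inv h"
    using assms h by (simp_all add: inv_mult_cancel m_assoc)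
  then show "h \<otimes> x \<in> H \<longleftrightarrow> x \<in> H" "x \<otimes> h \<in> H \<longleftrightarrow> x \<in> H"
    using assms by (metis m_closed m_inv_closed)+
qed

lemma H_inv_iff: "x \<in> carrier G \<Longrightarrow> inv x \<in> H \<longleftrightarrow> x \<in> H"
  by (metis inv_inv m_inv_closed)

lemma fused_right:
  assumes "x \<in> carrier G" "x \<notin> H" "h \<in> H"
  shows "(x, x \<otimes> h) \<in> R"
proof -
  have "x \<otimes> h \<otimes> inv x \<in> H" using assms by (simp add: inv_op_closed2)
  moreover have "x \<otimes> h \<otimes> inv x \<otimes> x = x \<otimes> h" using assms by (simp add: m_assoc)
  ultimately show ?thesis using fused assms by metis
qed

text \<open>Each class meeting \<open>A\<close> gets the value of \<open>f\<close> at a point of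
  \<open>A\<close> in it. The choice depends on \<open>x\<close> only through its class, and all
  classes missing \<open>A\<close> receive one common value.\<close>

lemma respects_extension:
  fixes f :: "'a \<Rightarrow> int"
  assumes "f respects (R \<inter> A \<times> A)"
  obtains F where "F respects R" "\<And>x. x \<in> carrier G \<Longrightarrow> x \<in> A \<Longrightarrow> F x = f x"
proof
  let ?F = "\<lambda>x. f (SOME y. y \<in> A \<and> (x, y) \<in> R)"
  show "?F respects R"
  proof (rule congruentI)
    fix x y assume "(x, y) \<in> R"
    then have "(x, z) \<in> R \<longleftrightarrow> (y, z) \<in> R" for z
      using related_trans related_sym by metis
    then show "?F x = ?F y" by simp
  qed
  fix x assume x: "x \<in> carrier G" "x \<in> A"
  define y where "y = (SOME y. y \<in> A \<and> (x, y) \<in> R)"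
  have "y \<in> A \<and> (x, y) \<in> R"
    unfolding y_def by (rule someI[of _ x]) (simp add: x related_refl)
  then have "f x = f y"
    using x by (intro congruentD[OF assms]) simp
  then show "?F x = f x"
    by (simp add: y_def)
qed

text \<open>At \<open>x\<close> in \<open>H\<close>, a term of the convolution over \<open>G\<close>
  with \<open>y\<close> off \<open>H\<close> does not depend on \<open>x\<close>, since
  \<open>inv y \<otimes> x\<close> and \<open>inv y\<close> lie in one class. Hence the convolutions
  over \<open>G\<close> and over \<open>H\<close> differ on \<open>H\<close> by a constant.\<close>

lemma schur_relation_restrict: "schur_relation (G\<lparr>carrier := H\<rparr>) (R \<inter> H \<times> H)"
proof -
  have H: "subgroup H G" ..
  interpret H: group "G\<lparr>carrier := H\<rparr>"
    by (rule subgroup_imp_group[OF H])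
  show ?thesis
  proof
    show "finite (carrier (G\<lparr>carrier := H\<rparr>))"
      using fin subset by (simp add: finite_subset)
    show "equiv (carrier (G\<lparr>carrier := H\<rparr>)) (R \<inter> H \<times> H)"
      by (rule equivI)
        (auto simp: refl_on_def sym_def trans_def intro: related_refl related_sym related_trans)
    show "x = \<one>\<^bsub>G\<lparr>carrier := H\<rparr>\<^esub>" if "(\<one>\<^bsub>G\<lparr>carrier := H\<rparr>\<^esub>, x) \<in> R \<inter> H \<times> H" for x
      using that class_one by simp
    show "(inv\<^bsub>G\<lparr>carrier := H\<rparr>\<^esub> x, inv\<^bsub>G\<lparr>carrier := H\<rparr>\<^esub> y) \<in> R \<inter> H \<times> H"
      if "(x, y) \<in> R \<inter> H \<times> H" for x y
      using that inv_related by (simp add: m_inv_consistent[OF H])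
    fix f g :: "'a \<Rightarrow> int"
    assume f: "f respects (R \<inter> H \<times> H)" and g: "g respects (R \<inter> H \<times> H)"
    obtain F where F: "F respects R" "\<And>x. x \<in> carrier G \<Longrightarrow> x \<in> H \<Longrightarrow> F x = f x"
      by (rule respects_extension[OF f]) blast
    obtain K where K: "K respects R" "\<And>x. x \<in> carrier G \<Longrightarrow> x \<in> H \<Longrightarrow> K x = g x"
      by (rule respects_extension[OF g]) blast
    have *: "conv G F K x = conv (G\<lparr>carrier := H\<rparr>) f g x + (\<Sum>y\<in>carrier G - H. F y * K (inv y))"
      if x: "x \<in> H" for x
    proof -
      have "conv G F K x = (\<Sum>y\<in>H. F y * K (inv y \<otimes> x)) + (\<Sum>y\<in>carrier G - H. F y * K (inv y \<otimes> x))"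
        unfolding conv_def by (subst sum.subset_diff[OF subset fin]) simp
      moreover have "(\<Sum>y\<in>H. F y * K (inv y \<otimes> x)) = conv (G\<lparr>carrier := H\<rparr>) f g x"
        unfolding conv_def using x F(2) K(2) by (simp add: m_inv_consistent[OF H])
      moreover have "K (inv y \<otimes> x) = K (inv y)" if "y \<in> carrier G - H" for y
        using fused_right[of "inv y" x] congruentD[OF K(1)] that x H_inv_iff by force
      ultimately show ?thesis by simp
    qed
    show "conv (G\<lparr>carrier := H\<rparr>) f g respects (R \<inter> H \<times> H)"
    proof (rule congruentI)
      fix x y assume "(x, y) \<in> R \<inter> H \<times> H"
      then show "conv (G\<lparr>carrier := H\<rparr>) f g x = conv (G\<lparr>carrier := H\<rparr>) f g y"
        using *[of x] *[of y] congruentD[OF conv_respects[OF F(1) K(1)], of x y] by simp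
    qed
  qed
qed

lemma central_relation_restrict:
  assumes "central_relation G R"
  shows "central_relation (G\<lparr>carrier := H\<rparr>) (R \<inter> H \<times> H)"
proof -
  have "subgroup H G" ..
  then show ?thesis
    using assms by (simp add: central_relation_def m_inv_consistent)
qed

text \<open>If exactly one of \<open>a\<close>, \<open>b\<close> lies in \<open>H\<close>, then
  \<open>b \<otimes> inv a\<close> is off \<open>H\<close>, and moving the point in \<open>H\<close>
  only shifts this quotient within its \<open>H\<close>-coset, hence within its class.\<close>

lemma relation_aut_extend:
  assumes f: "relation_aut (G\<lparr>carrier := H\<rparr>) (R \<inter> H \<times> H) f"
  shows "relation_aut G R (\<lambda>x. if x \<in> H then f x else x)"
proof -
  have H: "subgroup H G" ..
  have bij: "bij_betw f H H"
    and rel: "\<And>a b. a \<in> H \<Longrightarrow> b \<in> H \<Longrightarrow> (b \<otimes> inv a, f b \<otimes> inv (f a)) \<in> R"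
    using f by (auto simp: relation_aut_def m_inv_consistent[OF H] dest: bij_betwE)
  have fH: "f x \<in> H" if "x \<in> H" for x
    using bij that by (auto dest: bij_betwE)
  show ?thesis
    unfolding relation_aut_def
  proof (intro conjI ballI)
    have "bij_betw (\<lambda>x. if x \<in> H then f x else x) (H \<union> (carrier G - H)) (H \<union> (carrier G - H))"
      by (rule bij_betw_combine)
        (use bij in \<open>auto simp: bij_betw_def inj_on_def image_def\<close>)
    then show "bij_betw (\<lambda>x. if x \<in> H then f x else x) (carrier G) (carrier G)"
      by (simp add: Un_absorb1 subset)
    fix a b assume a: "a \<in> carrier G" and b: "b \<in> carrier G"
    show "(b \<otimes> inv a, (if b \<in> H then f b else b) \<otimes> inv (if a \<in> H then f a else a)) \<in> R"
    proof (cases "a \<in> H"; cases "b \<in> H")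
      assume aH: "a \<in> H" and bH: "b \<notin> H"
      have 1: "(b, b \<otimes> inv a) \<in> R" and 2: "(b, b \<otimes> inv (f a)) \<in> R"
        using fused_right[OF b bH] aH fH by simp_all
      show ?thesis
        using aH bH related_trans[OF related_sym[OF 1] 2] by simp
    next
      assume aH: "a \<notin> H" and bH: "b \<in> H"
      have 1: "(inv a, b \<otimes> inv a) \<in> R" and 2: "(inv a, f b \<otimes> inv a) \<in> R"
        using fused[of "inv a"] a aH bH fH H_inv_iff by simp_all
      show ?thesis
        using aH bH related_trans[OF related_sym[OF 1] 2] by simp
    qed (use a b rel in \<open>simp_all add: related_refl\<close>)
  qed
qed

section \<open>The induced relation on the quotient by \<open>H\<close>\<close>

definition quotient_relation :: "('a set \<times> 'a set) set" where
  "quotient_relation = {(H #> x, H #> y) | x y.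
     x \<in> carrier G \<and> y \<in> carrier G \<and> (x \<in> H \<and> y \<in> H \<or> x \<notin> H \<and> y \<notin> H \<and> (x, y) \<in> R)}"

lemma coset_eqE:
  assumes "H #> x = H #> y" "x \<in> carrier G" "y \<in> carrier G"
  obtains h where "h \<in> H" "x = h \<otimes> y"
proof -
  have "subgroup H G" ..
  then have "x \<in> H #> y"
    using assms rcos_self by metis
  then show thesis using that by (auto simp: r_coset_def)
qed

lemma coset_eq_iff:
  assumes a: "a \<in> carrier G" and b: "b \<in> carrier G"
  shows "H #> a = H #> b \<longleftrightarrow> a \<otimes> inv b \<in> H"
proof
  assume "H #> a = H #> b"
  then obtain h where "h \<in> H" "a = h \<otimes> b"
    using coset_eqE a b by metis
  then show "a \<otimes> inv b \<in> H" using b by (simp add: m_assoc)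
next
  have H: "subgroup H G" ..
  assume "a \<otimes> inv b \<in> H"
  moreover have "a = a \<otimes> inv b \<otimes> b" using a b by (simp add: m_assoc)
  ultimately have "a \<in> H #> b" unfolding r_coset_def by blast
  then show "H #> a = H #> b"
    using repr_independence[OF _ b H] by simp
qed

text \<open>The choice of representatives does not matter: off \<open>H\<close>, representatives of
  one coset are related by \<open>fused\<close>. The first disjunct accounts only for
  \<open>H\<close> paired with itself, so of a class meeting \<open>H\<close> and its complement
  just the part off \<open>H\<close> survives.\<close>

lemma quotient_relation_iff:
  assumes x: "x \<in> carrier G" and y: "y \<in> carrier G"
  shows "(H #> x, H #> y) \<in> quotient_relation \<longleftrightarrow>
     x \<in> H \<and> y \<in> H \<or> x \<notin> H \<and> y \<notin> H \<and> (x, y) \<in> R"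
proof
  assume "(H #> x, H #> y) \<in> quotient_relation"
  then obtain a b where eq: "H #> x = H #> a" "H #> y = H #> b"
    and ab: "a \<in> carrier G" "b \<in> carrier G" "a \<in> H \<and> b \<in> H \<or> a \<notin> H \<and> b \<notin> H \<and> (a, b) \<in> R"
    unfolding quotient_relation_def by blast
  obtain h where h: "h \<in> H" "x = h \<otimes> a"
    using coset_eqE[OF eq(1) x ab(1)] .
  obtain k where k: "k \<in> H" "y = k \<otimes> b"
    using coset_eqE[OF eq(2) y ab(2)] .
  have "(x, y) \<in> R" if "a \<notin> H" "b \<notin> H" "(a, b) \<in> R"
  proof -
    have "(a, x) \<in> R" "(b, y) \<in> R"
      using fused h k ab that by simp_all
    then show ?thesis
      using that(3) by (meson related_sym related_trans)
  qed
  then show "x \<in> H \<and> y \<in> H \<or> x \<notin> H \<and> y \<notin> H \<and> (x, y) \<in> R"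
    using ab h k by (auto simp: H_mult_iff)
qed (use assms in \<open>auto simp: quotient_relation_def\<close>)

lemma quotient_relation_subset:
  "quotient_relation \<subseteq> carrier (G Mod H) \<times> carrier (G Mod H)"
  by (auto simp: quotient_relation_def carrier_FactGroup)

lemma Mod_mult: "x \<in> carrier G \<Longrightarrow> y \<in> carrier G \<Longrightarrow> (H #> x) \<otimes>\<^bsub>G Mod H\<^esub> (H #> y) = H #> (x \<otimes> y)"
  by (simp add: rcos_sum)

lemma Mod_inv: "x \<in> carrier G \<Longrightarrow> inv\<^bsub>G Mod H\<^esub> (H #> x) = H #> inv x"
  by (simp add: inv_FactGroup carrier_FactGroup rcos_inv)

lemma coset_eq_H_iff: "x \<in> carrier G \<Longrightarrow> H #> x = H \<longleftrightarrow> x \<in> H"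
proof -
  have "subgroup H G" ..
  then show "x \<in> carrier G \<Longrightarrow> H #> x = H \<longleftrightarrow> x \<in> H"
    using coset_join1 coset_join2 subset by metis
qed

lemma sum_cosets:
  fixes f :: "'a set \<Rightarrow> int"
  shows "(\<Sum>y\<in>carrier G. f (H #> y)) = card H * (\<Sum>C\<in>carrier (G Mod H). f C)"
proof -
  have H: "subgroup H G" ..
  have "(\<Sum>y\<in>carrier G. f (H #> y)) =
      (\<Sum>C\<in>carrier (G Mod H). \<Sum>y\<in>{y \<in> carrier G. H #> y = C}. f (H #> y))"
    unfolding carrier_FactGroup by (rule sum.image_gen[OF fin])
  also have "\<dots> = (\<Sum>C\<in>carrier (G Mod H). card H * f C)"
  proof (rule sum.cong[OF refl])
    fix C assume "C \<in> carrier (G Mod H)"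
    then have C: "C \<in> rcosets H" by (simp add: FactGroup_def)
    then obtain x where x: "x \<in> carrier G" "C = H #> x"
      by (auto simp: RCOSETS_def)
    have "{y \<in> carrier G. H #> y = C} = C"
      using x rcos_self[OF _ H] repr_independence[OF _ _ H] r_coset_subset_G[OF subset x(1)] by blast
    moreover have "(\<Sum>y\<in>{y \<in> carrier G. H #> y = C}. f (H #> y)) =
        (\<Sum>y\<in>{y \<in> carrier G. H #> y = C}. f C)"
      by (rule sum.cong) simp_all
    ultimately show "(\<Sum>y\<in>{y \<in> carrier G. H #> y = C}. f (H #> y)) = card H * f C"
      using card_rcosets_equal[OF C subset] by simp
  qed
  finally show ?thesis by (simp add: sum_distrib_left)
qed

lemma conv_quotient:
  assumes x: "x \<in> carrier G"
  shows "conv G (\<lambda>y. f (H #> y)) (\<lambda>y. g (H #> y)) x = card H * conv (G Mod H) f g (H #> x)"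
proof -
  have "conv G (\<lambda>y. f (H #> y)) (\<lambda>y. g (H #> y)) x =
      (\<Sum>y\<in>carrier G. f (H #> y) * g (inv\<^bsub>G Mod H\<^esub> (H #> y) \<otimes>\<^bsub>G Mod H\<^esub> (H #> x)))"
    unfolding conv_def using x by (intro sum.cong) (simp_all add: Mod_inv rcos_sum)
  then show ?thesis
    unfolding conv_def by (simp only: sum_cosets[of "\<lambda>C. f C * g (inv\<^bsub>G Mod H\<^esub> C \<otimes>\<^bsub>G Mod H\<^esub> (H #> x))"])
qed

text \<open>Off \<open>H\<close> a function on \<open>G/H\<close> agrees with an element of the S-ring, and the correction
  supported on \<open>H\<close> contributes only multiples of the two factors to values off \<open>H\<close>.\<close>

lemma conv_quotient_respects:
  fixes f g :: "'a set \<Rightarrow> int"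
  assumes f: "f respects quotient_relation" and g: "g respects quotient_relation"
    and ab: "(a, b) \<in> R" "a \<notin> H" "b \<notin> H"
  shows "conv (G Mod H) f g (H #> a) = conv (G Mod H) f g (H #> b)"
proof -
  have H: "subgroup H G" ..
  let ?f = "\<lambda>x. f (H #> x)" and ?g = "\<lambda>x. g (H #> x)"
  have resp: "(\<lambda>x. k (H #> x)) respects (R \<inter> (- H) \<times> (- H))"
    if "k respects quotient_relation" for k :: "'a set \<Rightarrow> int"
    using that quotient_relation_iff related_carrier by (simp add: congruent_def) blast
  obtain F where F: "F respects R" "\<And>x. x \<in> carrier G \<Longrightarrow> x \<notin> H \<Longrightarrow> F x = ?f x"
    by (rule respects_extension[OF resp[OF f]]) simp
  obtain K where K: "K respects R" "\<And>x. x \<in> carrier G \<Longrightarrow> x \<notin> H \<Longrightarrow> K x = ?g x"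
    by (rule respects_extension[OF resp[OF g]]) simp
  define p where "p x = ?f x - F x" for x
  define q where "q x = ?g x - K x" for x
  have p: "p x = 0" if "x \<in> carrier G" "x \<notin> H" for x
    using F(2)[OF that] by (simp add: p_def)
  have q: "q x = 0" if "x \<in> carrier G" "x \<notin> H" for x
    using K(2)[OF that] by (simp add: q_def)
  have *: "conv G ?f ?g x = conv G F K x + sum p (carrier G) * K x + F x * sum q (carrier G)"
    if x: "x \<in> carrier G" "x \<notin> H" for x
  proof -
    \<comment> \<open>The summand is split as \<open>F K + p K + ?f q\<close>; keeping
      \<open>?f\<close> whole in the last term avoids a product of two corrections.\<close>
    have "conv G ?f ?g x = (\<Sum>y\<in>carrier G. F y * K (inv y \<otimes> x) + p y * K (inv y \<otimes> x)
        + ?f y * q (inv y \<otimes> x))"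
      unfolding conv_def by (rule sum.cong) (simp_all add: p_def q_def algebra_simps)
    also have "\<dots> = (\<Sum>y\<in>carrier G. F y * K (inv y \<otimes> x) + p y * K x + F x * q (inv y \<otimes> x))"
    proof (rule sum.cong[OF refl])
      fix y assume y: "y \<in> carrier G"
      \<comment> \<open>Either \<open>p y\<close> vanishes, or \<open>y\<close> is in
        \<open>H\<close> and \<open>inv y \<otimes> x\<close> is in the class of
        \<open>x\<close>.\<close>
      have 1: "p y * K (inv y \<otimes> x) = p y * K x"
        using p[of y] y fused[OF x, of "inv y"] congruentD[OF K(1)] by (cases "y \<in> H") force+
      \<comment> \<open>Where \<open>q\<close> can be nonzero, \<open>x\<close> and \<open>y\<close>
        lie in the same coset, so \<open>?f y\<close> is \<open>?f x\<close>, which equals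
        \<open>F x\<close> off \<open>H\<close>.\<close>
      have 2: "?f y * q (inv y \<otimes> x) = F x * q (inv y \<otimes> x)"
      proof (cases "inv y \<otimes> x \<in> H")
        case True
        then have "y \<otimes> (inv y \<otimes> x) \<otimes> inv y \<in> H"
          using y by (intro inv_op_closed2)
        then have "x \<otimes> inv y \<in> H"
          using x y by (simp add: inv_mult_cancel)
        then have "H #> x = H #> y" using x y by (simp add: coset_eq_iff)
        then show ?thesis using F(2) x by simp
      qed (use q x y in simp)
      show "F y * K (inv y \<otimes> x) + p y * K (inv y \<otimes> x) + ?f y * q (inv y \<otimes> x) =
          F y * K (inv y \<otimes> x) + p y * K x + F x * q (inv y \<otimes> x)"
        by (simp only: 1 2)
    qed
    also have "\<dots> = conv G F K x + sum p (carrier G) * K x + F x * (\<Sum>y\<in>carrier G. q (inv y \<otimes> x))"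
      by (simp add: conv_def sum.distrib sum_distrib_left sum_distrib_right)
    also have "(\<Sum>y\<in>carrier G. q (inv y \<otimes> x)) = sum q (carrier G)"
      by (rule sum.reindex_bij_betw)
        (rule bij_betw_byWitness[where f' = "\<lambda>w. x \<otimes> inv w"],
          use x in \<open>auto simp: inv_mult_group m_assoc inv_mult_cancel\<close>)
    finally show ?thesis .
  qed
  have "conv G ?f ?g a = conv G ?f ?g b"
    using *[OF related_carrier(1)[OF ab(1)] ab(2)] *[OF related_carrier(2)[OF ab(1)] ab(3)]
      congruentD[OF F(1) ab(1)] congruentD[OF K(1) ab(1)]
      congruentD[OF conv_respects[OF F(1) K(1)] ab(1)]
    by simp
  moreover have "card H \<noteq> 0"
    unfolding card_eq_0_iff using finite_subset[OF subset fin] subgroup.one_closed[OF H] by blast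
  ultimately show ?thesis
    using related_carrier[OF ab(1)] by (simp add: conv_quotient)
qed

lemma schur_relation_quotient: "schur_relation (G Mod H) quotient_relation"
proof -
  interpret Q: group "G Mod H" by (rule factorgroup_is_group)
  show ?thesis
  proof
    show "finite (carrier (G Mod H))"
      using fin by (simp add: carrier_FactGroup)
    show "equiv (carrier (G Mod H)) quotient_relation"
    proof (rule equivI)
      show "quotient_relation \<subseteq> carrier (G Mod H) \<times> carrier (G Mod H)"
        by (rule quotient_relation_subset)
      show "refl_on (carrier (G Mod H)) quotient_relation"
        by (rule refl_onI) (auto simp: carrier_FactGroup quotient_relation_iff related_refl)
      show "sym quotient_relation"
        by (rule symI) (auto simp: quotient_relation_def intro: related_sym)
      show "trans quotient_relation"
      proof (rule transI)
        fix A B C assume AB: "(A, B) \<in> quotient_relation" and BC: "(B, C) \<in> quotient_relation"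
        then have "A \<in> carrier (G Mod H)" "B \<in> carrier (G Mod H)" "C \<in> carrier (G Mod H)"
          using quotient_relation_subset by blast+
        then obtain x y z where "A = H #> x" "B = H #> y" "C = H #> z"
          "x \<in> carrier G" "y \<in> carrier G" "z \<in> carrier G"
          unfolding carrier_FactGroup by blast
        then show "(A, C) \<in> quotient_relation"
          using AB BC by (auto simp: quotient_relation_iff intro: related_trans)
      qed
    qed
    show "C = \<one>\<^bsub>G Mod H\<^esub>" if "(\<one>\<^bsub>G Mod H\<^esub>, C) \<in> quotient_relation" for C
      using that coset_eq_H_iff unfolding quotient_relation_def by auto
    show "(inv\<^bsub>G Mod H\<^esub> A, inv\<^bsub>G Mod H\<^esub> B) \<in> quotient_relation"
      if AB: "(A, B) \<in> quotient_relation" for A B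
    proof -
      obtain x y where "A = H #> x" "B = H #> y" "x \<in> carrier G" "y \<in> carrier G"
        "x \<in> H \<and> y \<in> H \<or> x \<notin> H \<and> y \<notin> H \<and> (x, y) \<in> R"
        using AB unfolding quotient_relation_def by blast
      then show ?thesis
        by (auto simp: Mod_inv quotient_relation_iff H_inv_iff inv_related)
    qed
    fix f g :: "'a set \<Rightarrow> int"
    assume f: "f respects quotient_relation" and g: "g respects quotient_relation"
    show "conv (G Mod H) f g respects quotient_relation"
    proof (rule congruentI)
      fix A B assume "(A, B) \<in> quotient_relation"
      then consider "A = H" "B = H"
        | a b where "A = H #> a" "B = H #> b" "(a, b) \<in> R" "a \<notin> H" "b \<notin> H"
        unfolding quotient_relation_def using coset_eq_H_iff by blast
      then show "conv (G Mod H) f g A = conv (G Mod H) f g B"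
        by cases (use conv_quotient_respects[OF f g] in auto)
    qed
  qed
qed

lemma central_relation_quotient:
  assumes "central_relation G R"
  shows "central_relation (G Mod H) quotient_relation"
  unfolding central_relation_def
proof (intro ballI)
  fix A B assume "A \<in> carrier (G Mod H)" "B \<in> carrier (G Mod H)"
  then obtain x g where x: "x \<in> carrier G" "A = H #> x" and g: "g \<in> carrier G" "B = H #> g"
    by (auto simp: carrier_FactGroup)
  have "(x, g \<otimes> x \<otimes> inv g) \<in> R"
    using assms x g by (simp add: central_relation_def)
  moreover have "g \<otimes> x \<otimes> inv g \<in> H \<longleftrightarrow> x \<in> H"
  proof
    assume "g \<otimes> x \<otimes> inv g \<in> H"
    then have "inv g \<otimes> (g \<otimes> x \<otimes> inv g) \<otimes> g \<in> H"
      using g by (intro inv_op_closed1)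
    then show "x \<in> H" using x g by (simp add: m_assoc inv_mult_cancel)
  qed (use g in \<open>simp add: inv_op_closed2\<close>)
  ultimately show "(A, B \<otimes>\<^bsub>G Mod H\<^esub> A \<otimes>\<^bsub>G Mod H\<^esub> inv\<^bsub>G Mod H\<^esub> B) \<in> quotient_relation"
    using x g by (simp add: Mod_inv rcos_sum quotient_relation_iff)
qed

text \<open>On each coset \<open>C\<close> the lift is a right multiplication taking
  \<open>r C\<close> to \<open>s (f C)\<close>, so quotients of points in one coset are unchanged.
  For points in different cosets the quotient is off \<open>H\<close>, where its coset determines
  its class. The freedom in \<open>r\<close> and \<open>s\<close> allows one prescribed point to be
  sent to another.\<close>

lemma relation_aut_lift:
  assumes f: "relation_aut (G Mod H) quotient_relation f"
    and r: "\<And>C. C \<in> carrier (G Mod H) \<Longrightarrow> r C \<in> C"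
    and s: "\<And>C. C \<in> carrier (G Mod H) \<Longrightarrow> s C \<in> C"
  shows "relation_aut G R (\<lambda>x. x \<otimes> inv (r (H #> x)) \<otimes> s (f (H #> x)))"
    (is "relation_aut G R ?f")
proof -
  have H: "subgroup H G" ..
  interpret Q: schur_relation "G Mod H" quotient_relation
    by (rule schur_relation_quotient)
  have Hx: "H #> x \<in> carrier (G Mod H)" if "x \<in> carrier G" for x
    using that by (simp add: carrier_FactGroup)
  have coset: "C \<subseteq> carrier G" "x \<in> C \<Longrightarrow> H #> x = C" if "C \<in> carrier (G Mod H)" for C x
    using that r_coset_subset_G[OF subset] repr_independence[OF _ _ H]
    by (auto simp: carrier_FactGroup)
  have rc: "r C \<in> carrier G" "H #> r C = C" if "C \<in> carrier (G Mod H)" for C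
    using coset[OF that] r[OF that] by auto
  have sc: "s C \<in> carrier G" "H #> s C = C" if "C \<in> carrier (G Mod H)" for C
    using coset[OF that] s[OF that] by auto
  have closed: "?f x \<in> carrier G" if "x \<in> carrier G" for x
    using that rc sc Q.relation_autD(1)[OF f] Hx by simp
  have pi: "H #> ?f x = f (H #> x)" if x: "x \<in> carrier G" for x
  proof -
    note rc = rc[OF Hx[OF x]] and sc = sc[OF Q.relation_autD(1)[OF f Hx[OF x]]]
    have "x \<otimes> inv (r (H #> x)) \<in> H"
      using coset_eq_iff[OF x rc(1)] rc(2) by simp
    then have "H #> (x \<otimes> inv (r (H #> x))) = H"
      using x rc(1) by (simp add: coset_eq_H_iff)
    moreover have "H #> ?f x = H #> (x \<otimes> inv (r (H #> x))) #> s (f (H #> x))"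
      using x rc(1) sc(1) by (simp add: coset_mult_assoc subset)
    ultimately show ?thesis
      using sc(2) by simp
  qed
  have same: "?f b \<otimes> inv (?f a) = b \<otimes> inv a"
    if "a \<in> carrier G" "b \<in> carrier G" "H #> a = H #> b" for a b
    using that rc[OF Hx] sc[OF Q.relation_autD(1)[OF f Hx]]
    by (simp add: inv_mult_group m_assoc inv_mult_cancel)
  show ?thesis
    unfolding relation_aut_def
  proof (intro conjI ballI)
    have "inj_on ?f (carrier G)"
    proof (rule inj_onI)
      fix a b assume ab: "a \<in> carrier G" "b \<in> carrier G" "?f a = ?f b"
      then have "f (H #> a) = f (H #> b)" using pi by metis
      then have "H #> a = H #> b"
        using Q.relation_autD(2)[OF f] ab Hx by (metis bij_betw_def inj_onD)
      then have "b \<otimes> inv a = \<one>"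
        using same[OF ab(1,2)] closed[OF ab(1)] ab(3) by simp
      then show "a = b" using ab by (metis inv_equality inv_inv inv_closed)
    qed
    moreover have "?f ` carrier G \<subseteq> carrier G" using closed by auto
    ultimately show "bij_betw ?f (carrier G) (carrier G)"
      unfolding bij_betw_def using endo_inj_surj[OF fin] by simp
    fix a b assume ab: "a \<in> carrier G" "b \<in> carrier G"
    show "(b \<otimes> inv a, ?f b \<otimes> inv (?f a)) \<in> R"
    proof (cases "H #> a = H #> b")
      case True
      then show ?thesis using same[OF ab] ab by (simp add: related_refl)
    next
      case False
      have fab: "?f a \<in> carrier G" "?f b \<in> carrier G" using closed ab by simp_all
      have "((H #> b) \<otimes>\<^bsub>G Mod H\<^esub> inv\<^bsub>G Mod H\<^esub> (H #> a),
          (H #> ?f b) \<otimes>\<^bsub>G Mod H\<^esub> inv\<^bsub>G Mod H\<^esub> (H #> ?f a)) \<in> quotient_relation"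
        using Q.relation_autD(3)[OF f Hx[OF ab(1)] Hx[OF ab(2)]] pi[OF ab(1)] pi[OF ab(2)] by (simp only:)
      then have "(H #> (b \<otimes> inv a), H #> (?f b \<otimes> inv (?f a))) \<in> quotient_relation"
        by (simp only: Mod_inv Mod_mult ab fab inv_closed)
      moreover have "b \<otimes> inv a \<notin> H"
        using False ab coset_eq_iff[of b a] by simp
      ultimately show ?thesis
        using quotient_relation_iff[of "b \<otimes> inv a" "?f b \<otimes> inv (?f a)"] ab fab by blast
    qed
  qed
qed

end

section \<open>Basic sets meeting the subgroup and its complement\<close>

context schur_relation begin

text \<open>These cardinalities are the structure constants: the coefficients of a product of two
  class sums, and such a product is constant on classes.\<close>

lemma card_products_related:
  assumes "(z, z') \<in> R"
  shows "card {x. (a, x) \<in> R \<and> (b, inv x \<otimes> z) \<in> R} = card {x. (a, x) \<in> R \<and> (b, inv x \<otimes> z') \<in> R}"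
proof -
  let ?f = "indicator (R `` {a}) :: 'a \<Rightarrow> int" and ?g = "indicator (R `` {b}) :: 'a \<Rightarrow> int"
  have "conv G ?f ?g w = card {x. (a, x) \<in> R \<and> (b, inv x \<otimes> w) \<in> R}" for w
  proof -
    have "conv G ?f ?g w = (\<Sum>x\<in>carrier G. indicator {x. (a, x) \<in> R \<and> (b, inv x \<otimes> w) \<in> R} x)"
      unfolding conv_def by (intro sum.cong) (auto simp: indicator_def)
    also have "\<dots> = card (carrier G \<inter> {x. (a, x) \<in> R \<and> (b, inv x \<otimes> w) \<in> R})"
      using fin by (simp add: indicator_def)
    also have "carrier G \<inter> {x. (a, x) \<in> R \<and> (b, inv x \<otimes> w) \<in> R} =
        {x. (a, x) \<in> R \<and> (b, inv x \<otimes> w) \<in> R}"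
      using related_carrier(2) by blast
    finally show ?thesis .
  qed
  moreover have "conv G ?f ?g z = conv G ?f ?g z'"
    using congruentD[OF conv_respects[OF indicator_respects indicator_respects] assms] .
  ultimately show ?thesis by simp
qed

lemma finite_class: "finite {x. (a, x) \<in> R \<and> P x}"
  using fin by (rule rev_finite_subset) (use related_carrier(2) in blast)

text \<open>If left division of \<open>z'\<close> by the whole class of \<open>a\<close> stays in the class of \<open>b\<close>, then the
  structure constant is as large as possible, so the same holds for every \<open>z\<close> related to \<open>z'\<close>.\<close>

lemma class_translate:
  assumes z: "(z, z') \<in> R" and all: "\<And>x. (a, x) \<in> R \<Longrightarrow> (b, inv x \<otimes> z') \<in> R"
    and x: "(a, x) \<in> R"
  shows "(b, inv x \<otimes> z) \<in> R"
proof -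
  let ?D = "{x. (a, x) \<in> R \<and> (b, inv x \<otimes> z) \<in> R}"
  have "card ?D = card {x. (a, x) \<in> R \<and> (b, inv x \<otimes> z') \<in> R}"
    by (rule card_products_related[OF z])
  also have "{x. (a, x) \<in> R \<and> (b, inv x \<otimes> z') \<in> R} = {x. (a, x) \<in> R \<and> True}"
    using all by blast
  finally have "?D = {x. (a, x) \<in> R \<and> True}"
    by (intro card_subset_eq finite_class) auto
  then show ?thesis using x by blast
qed

end

context fused_relation begin

text \<open>Here \<open>?D z\<close> collects the factorizations of \<open>z\<close> over the
  classes of \<open>x1\<close> and \<open>y1\<close>, and its size agrees at related points. If the
  classes are not mutually inverse, comparing \<open>y1\<close> with \<open>y2\<close> and
  \<open>x1\<close> with \<open>x2\<close> makes \<open>x \<mapsto> inv x \<otimes> y1\<close> a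
  bijection from \<open>?X\<close> onto \<open>?Y\<close>. Some \<open>x\<close> is then sent to
  \<open>y1\<close>, which makes \<open>x\<close> the identity.\<close>

lemma mixed_inverse:
  assumes x: "(x1, x2) \<in> R" "x1 \<in> H" "x2 \<notin> H" and y: "(y1, y2) \<in> R" "y1 \<in> H" "y2 \<notin> H"
  shows "(inv x1, y1) \<in> R"
proof (rule ccontr)
  assume not: "(inv x1, y1) \<notin> R"
  have H: "subgroup H G" ..
  let ?D = "\<lambda>z. {x. (x1, x) \<in> R \<and> (y1, inv x \<otimes> z) \<in> R}"
  let ?X = "{x. (x1, x) \<in> R \<and> x \<in> H}" and ?Y = "{y. (y1, y) \<in> R \<and> y \<in> H}"
  note xc = related_carrier[OF x(1)] and yc = related_carrier[OF y(1)]
  \<comment> \<open>A first factor \<open>x\<close> off \<open>H\<close> would put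
    \<open>inv x \<otimes> z\<close> into the class of \<open>inv x\<close>, and the two classes
    would be inverse to each other.\<close>
  have D_sub: "?D z \<subseteq> ?X" if z: "z \<in> H" for z
  proof
    fix x assume D: "x \<in> ?D z"
    then have xx: "(x1, x) \<in> R" "(y1, inv x \<otimes> z) \<in> R" by auto
    have "x \<in> H"
    proof (rule ccontr)
      assume "x \<notin> H"
      then have "(inv x, inv x \<otimes> z) \<in> R"
        using fused_right[of "inv x" z] related_carrier(2)[OF xx(1)] z by (simp add: H_inv_iff)
      then have "(y1, inv x) \<in> R" using xx(2) by (meson related_sym related_trans)
      then show False
        using not inv_related[OF xx(1)] by (meson related_sym related_trans)
    qed
    then show "x \<in> ?X" using xx by simp
  qed
  \<comment> \<open>As \<open>y2\<close> is off \<open>H\<close>, dividing it by elements of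
    \<open>H\<close> stays in its class.\<close>
  have "?X \<subseteq> ?D y2"
  proof
    fix x assume "x \<in> ?X"
    then have xx: "(x1, x) \<in> R" "x \<in> H" by auto
    then have "(y2, inv x \<otimes> y2) \<in> R" using fused[OF yc(2) y(3)] by simp
    then show "x \<in> ?D y2" using xx y(1) related_trans by blast
  qed
  then have "card ?X \<le> card (?D y2)" by (intro card_mono finite_class)
  also have "\<dots> = card (?D y1)" by (rule card_products_related[OF related_sym[OF y(1)]])
  finally have D_y1: "?D y1 = ?X"
    using D_sub[OF y(2)] by (intro card_seteq finite_class)
  \<comment> \<open>Symmetrically, each \<open>y\<close> in \<open>?Y\<close> splits off from
    \<open>x2\<close> on the right, which bounds \<open>?Y\<close> by \<open>?X\<close>.\<close>
  have "card ?Y \<le> card (?D x2)"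
  proof (rule card_inj_on_le[where f = "\<lambda>y. x2 \<otimes> inv y"])
    show "inj_on (\<lambda>y. x2 \<otimes> inv y) ?Y"
      by (rule inj_onI) (use xc related_carrier in auto)
    show "(\<lambda>y. x2 \<otimes> inv y) ` ?Y \<subseteq> ?D x2"
    proof (rule image_subsetI)
      fix y assume "y \<in> ?Y"
      then have yy: "(y1, y) \<in> R" "y \<in> H" by auto
      then have "(x2, x2 \<otimes> inv y) \<in> R" using fused_right[OF xc(2) x(3)] by simp
      then have "(x1, x2 \<otimes> inv y) \<in> R" by (rule related_trans[OF x(1)])
      moreover have "inv (x2 \<otimes> inv y) \<otimes> x2 = y"
        using xc yy by (simp add: inv_mult_group m_assoc)
      ultimately show "x2 \<otimes> inv y \<in> ?D x2"
        using yy by simp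
    qed
  qed (rule finite_class)
  also have "\<dots> = card (?D x1)" by (rule card_products_related[OF related_sym[OF x(1)]])
  also have "\<dots> \<le> card ?X" using D_sub[OF x(2)] by (intro card_mono finite_class)
  finally have card: "card ?Y \<le> card ?X" .
  \<comment> \<open>The equality \<open>D_y1\<close> gives the inclusion, and the cardinality bound
    makes it an equality.\<close>
  have "(\<lambda>x. inv x \<otimes> y1) ` ?X = ?Y"
  proof (rule card_seteq)
    show "(\<lambda>x. inv x \<otimes> y1) ` ?X \<subseteq> ?Y"
      using D_y1 y(2) subgroup.m_closed[OF H] by auto
    have "inj_on (\<lambda>x. inv x \<otimes> y1) ?X"
      by (rule inj_onI) (use yc related_carrier in auto)
    then show "card ?Y \<le> card ((\<lambda>x. inv x \<otimes> y1) ` ?X)"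
      using card by (simp add: card_image)
  qed (rule finite_class)
  then have "y1 \<in> (\<lambda>x. inv x \<otimes> y1) ` ?X" using y yc by (simp add: related_refl)
  then obtain z where z: "(x1, z) \<in> R" "z \<in> H" "y1 = inv z \<otimes> y1" by blast
  have "inv z = \<one>" using z(2,3) yc r_cancel_one'[of y1 "inv z"] by simp
  then have "z = \<one>" using z by (metis inv_eq_1_iff mem_carrier)
  then have "x1 = \<one>" using z(1) class_one related_sym by blast
  then have "x2 = \<one>" using x(1) class_one by blast
  then show False using x(3) subgroup.one_closed[OF H] by simp
qed

end

section \<open>The class meeting both \<open>H\<close> and its complement, and the subgroups
  \<open>U\<close> and \<open>V\<close> below and above \<open>H\<close>\<close>

locale mixed_class = fused_relation +
  fixes x1 x2
  assumes mixed: "(x1, x2) \<in> R" "x1 \<in> H" "x2 \<notin> H"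
begin

text \<open>By \<open>mixed_inverse\<close> any two such classes are inverse to each other, and this
  applies also to a class paired with itself.\<close>

lemma mixed_unique:
  assumes "(y1, y2) \<in> R" "y1 \<in> H" "y2 \<notin> H"
  shows "(x1, y1) \<in> R"
  using mixed_inverse[OF mixed mixed] mixed_inverse[OF mixed assms]
  by (meson related_sym related_trans)

lemma mixed_inv: "(x1, x) \<in> R \<Longrightarrow> (x1, inv x) \<in> R"
  using mixed_inverse[OF mixed mixed] inv_related by (meson related_sym related_trans)

definition U where "U = {u \<in> H. \<forall>z. (u, z) \<in> R \<longrightarrow> z \<in> H}"

definition V where "V = U \<union> R `` {x1}"

lemma U_subset: "U \<subseteq> H" by (auto simp: U_def)

lemma U_carrier: "u \<in> U \<Longrightarrow> u \<in> carrier G" using U_subset by auto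

lemma U_related: "u \<in> U \<Longrightarrow> (u, z) \<in> R \<Longrightarrow> z \<in> U"
  by (simp add: U_def) (meson related_trans)

lemma U_class: "u \<in> U \<Longrightarrow> (x1, u) \<notin> R"
proof
  assume u: "u \<in> U" and "(x1, u) \<in> R"
  then have "(u, x2) \<in> R" using mixed(1) by (meson related_sym related_trans)
  then show False using u mixed(3) by (simp add: U_def)
qed

lemma H_cases: "h \<in> H \<Longrightarrow> h \<in> U \<or> (x1, h) \<in> R"
  using mixed_unique by (auto simp: U_def)

lemma U_one: "\<one> \<in> U"
  by (auto simp: U_def dest!: class_one)

lemma U_inv:
  assumes "u \<in> U" shows "inv u \<in> U"
proof -
  have "z \<in> H" if z: "(inv u, z) \<in> R" for z
  proof -
    have "(u, inv z) \<in> R" using inv_related[OF z] U_carrier[OF assms] by simp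
    then show ?thesis
      using assms related_carrier(2)[OF z] H_inv_iff by (auto simp: U_def)
  qed
  then show ?thesis using assms by (simp add: U_def)
qed

text \<open>An element related to \<open>u \<otimes> v\<close> has as many factorizations over the
  classes of \<open>u\<close> and \<open>v\<close>, hence at least one, and both factors lie in
  \<open>H\<close>.\<close>

lemma U_mult:
  assumes u: "u \<in> U" and v: "v \<in> U"
  shows "u \<otimes> v \<in> U"
proof -
  have H: "subgroup H G" ..
  have uv: "u \<in> H" "v \<in> H" using u v U_subset by auto
  have "z \<in> H" if z: "(u \<otimes> v, z) \<in> R" for z
  proof -
    let ?D = "\<lambda>z. {x. (u, x) \<in> R \<and> (v, inv x \<otimes> z) \<in> R}"
    have "u \<in> ?D (u \<otimes> v)"
      using uv by (simp add: inv_mult_cancel related_refl)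
    then have "card (?D (u \<otimes> v)) \<noteq> 0"
      by (subst card_0_eq[OF finite_class]) blast
    then have "card (?D z) \<noteq> 0"
      using card_products_related[OF z, of u v] by simp
    then have "?D z \<noteq> {}" by (metis card.empty)
    then obtain x where x: "(u, x) \<in> R" "(v, inv x \<otimes> z) \<in> R" by blast
    then have "x \<in> H" "inv x \<otimes> z \<in> H" using u v by (auto simp: U_def)
    then show "z \<in> H" using related_carrier(2)[OF z] H_mult_iff(1)[of z "inv x"] by simp
  qed
  then show ?thesis using uv subgroup.m_closed[OF H] by (simp add: U_def)
qed

lemma V_carrier: "v \<in> V \<Longrightarrow> v \<in> carrier G"
  using U_carrier related_carrier(2) by (auto simp: V_def)

lemma V_inv: "v \<in> V \<Longrightarrow> inv v \<in> V"
  using U_inv mixed_inv by (auto simp: V_def)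

lemma H_subset_V: "H \<subseteq> V"
  using H_cases by (auto simp: V_def)

lemma V_related: "v \<in> V \<Longrightarrow> (v, z) \<in> R \<Longrightarrow> z \<in> V"
  using U_related[of v z] related_trans[of x1 v z] by (auto simp: V_def)

text \<open>For \<open>v\<close> off \<open>H\<close>, the element \<open>inv v\<close> is related
  to \<open>x1\<close>, which is in \<open>H\<close>. The class of \<open>z\<close> avoids
  \<open>H\<close>, so fusion shows that dividing \<open>x1\<close> by any member of that class
  stays in the class of \<open>inv z\<close>; \<open>class_translate\<close> carries this over to
  \<open>inv v\<close>.\<close>

lemma V_translate:
  assumes v: "v \<in> V" and z: "z \<in> carrier G" "z \<notin> V"
  shows "(z, v \<otimes> z) \<in> R"
proof -
  have notH: "x \<notin> H" if "(z, x) \<in> R" for x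
    using V_related[OF _ related_sym[OF that]] H_subset_V z by blast
  show ?thesis
  proof (cases "v \<in> H")
    case True
    then show ?thesis using fused z H_subset_V by blast
  next
    case False
    then have "(x1, inv v) \<in> R" using v mixed_inv U_subset by (auto simp: V_def)
    have "(inv z, inv z \<otimes> inv v) \<in> R"
    proof (rule class_translate)
      show "(inv v, x1) \<in> R" by (rule related_sym) fact
      show "(z, z) \<in> R" using z by (simp add: related_refl)
      fix x assume zx: "(z, x) \<in> R"
      then have xc: "x \<in> carrier G" by (rule related_carrier)
      have "(inv x, inv x \<otimes> x1) \<in> R"
        using notH[OF zx] xc mixed(2) by (intro fused_right) (simp_all add: H_inv_iff)
      then show "(inv z, inv x \<otimes> x1) \<in> R" using inv_related[OF zx] related_trans by blast
    qed
    then have "(inv (inv z), inv (inv z \<otimes> inv v)) \<in> R" by (rule inv_related)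
    then show ?thesis using z V_carrier[OF v] by (simp add: inv_mult_group)
  qed
qed

text \<open>Were the product outside \<open>V\<close>, left translation by \<open>inv a\<close>
  would relate it to \<open>b\<close>, although \<open>V\<close> is a union of classes.\<close>

lemma V_mult:
  assumes a: "a \<in> V" and b: "b \<in> V"
  shows "a \<otimes> b \<in> V"
proof (rule ccontr)
  assume not: "a \<otimes> b \<notin> V"
  have "(a \<otimes> b, inv a \<otimes> (a \<otimes> b)) \<in> R"
    using V_translate[OF V_inv[OF a] _ not] a b V_carrier by simp
  then have "(b, a \<otimes> b) \<in> R"
    using a b V_carrier by (simp add: inv_mult_cancel related_sym)
  with V_related[OF b] not show False by blast
qed

lemma V_translate_right:
  assumes v: "v \<in> V" and z: "z \<in> carrier G" "z \<notin> V"
  shows "(z, z \<otimes> v) \<in> R"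
proof -
  have "inv z \<notin> V" using V_inv[of "inv z"] z by auto
  then have "(inv z, inv v \<otimes> inv z) \<in> R"
    using V_translate[OF V_inv[OF v]] z by simp
  then show ?thesis
    using inv_related[of "inv z" "inv v \<otimes> inv z"] z V_carrier[OF v] by (simp add: inv_mult_group)
qed

text \<open>The difference of \<open>V\<close> and \<open>U\<close> is a single class, so two
  elements of \<open>V\<close> that avoid \<open>U\<close> are automatically related.\<close>

lemma related_iff_V: "v \<in> V \<Longrightarrow> v \<notin> U \<longleftrightarrow> (x1, v) \<in> R"
  using U_class by (auto simp: V_def)

text \<open>On \<open>U #> x\<close> this is right multiplication by
  \<open>inv x \<otimes> y\<close>, on \<open>U #> y\<close> by its inverse, so quotients within one
  coset of \<open>U\<close> are kept.\<close>

definition swap where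
  "swap x y g = (if g \<otimes> inv x \<in> U then g \<otimes> inv x \<otimes> y else if g \<otimes> inv y \<in> U then g \<otimes> inv y \<otimes> x else g)"

text \<open>The cases follow the quotient \<open>b \<otimes> inv a\<close>. In \<open>U\<close> it
  is unchanged; in \<open>V\<close> off \<open>U\<close> its image stays in \<open>V\<close> and off
  \<open>U\<close>, which is one class; outside \<open>V\<close> it is multiplied on both sides by
  elements of \<open>V\<close>, which keeps its class.\<close>

lemma relation_aut_swap:
  assumes x: "(x1, x) \<in> R" and y: "(x1, y) \<in> R" and ne: "x \<otimes> inv y \<notin> U"
  shows "relation_aut G R (swap x y)" "swap x y \<one> = \<one>" "swap x y x = y" "swap x y y = x"
proof -
  note xc = related_carrier(2)[OF x] and yc = related_carrier(2)[OF y]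
  have xV: "x \<in> V" and yV: "y \<in> V" using x y by (auto simp: V_def)
  have ne': "y \<otimes> inv x \<notin> U"
    using U_inv[of "y \<otimes> inv x"] ne xc yc by (auto simp: inv_mult_group)
  let ?f = "swap x y"
  have closed: "?f g \<in> carrier G" if "g \<in> carrier G" for g
    using that xc yc by (simp add: swap_def)
  have U_mult_iff: "u \<otimes> w \<in> U \<longleftrightarrow> w \<in> U" if "u \<in> U" "w \<in> carrier G" for u w
    using U_mult[of u w] U_mult[OF U_inv[of u], of "u \<otimes> w"] that U_carrier
    by (auto simp: inv_mult_cancel)
  have invol: "?f (?f g) = g" if g: "g \<in> carrier G" for g
  proof -
    consider "g \<otimes> inv x \<in> U" | "g \<otimes> inv x \<notin> U" "g \<otimes> inv y \<in> U"
      | "g \<otimes> inv x \<notin> U" "g \<otimes> inv y \<notin> U" by blast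
    then show ?thesis
    proof cases
      case 1
      then have "g \<otimes> inv x \<otimes> (y \<otimes> inv x) \<notin> U"
        using U_mult_iff[OF 1, of "y \<otimes> inv x"] ne' xc yc by simp
      then show ?thesis
        using 1 g xc yc by (simp add: swap_def m_assoc inv_mult_cancel)
    next
      case 2
      then show ?thesis
        using g xc yc by (simp add: swap_def m_assoc inv_mult_cancel)
    qed (simp add: swap_def)
  qed
  have moved: "?f g \<otimes> inv g \<in> V" if g: "g \<in> carrier G" for g
  proof -
    \<comment> \<open>Here \<open>g\<close> is \<open>a \<otimes> c\<close> and its image is
      \<open>a \<otimes> b\<close>, so the quotient is a product of four elements of
      \<open>V\<close>.\<close>
    have *: "a \<otimes> b \<otimes> inv g \<in> V" if "a = g \<otimes> inv c" "a \<in> U" "c \<in> V" "b \<in> V" for a b c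
    proof -
      have "inv g = inv c \<otimes> inv a"
        using that g V_carrier[OF \<open>c \<in> V\<close>] by (simp add: inv_mult_group inv_mult_cancel)
      then show ?thesis
        using that V_mult V_inv by (simp add: V_def)
    qed
    have "\<one> \<in> V" using U_one by (simp add: V_def)
    then show ?thesis
      using *[of "g \<otimes> inv x" x y] *[of "g \<otimes> inv y" y x] xV yV g by (simp add: swap_def)
  qed
  have same: "?f b \<otimes> inv (?f a) = b \<otimes> inv a"
    if a: "a \<in> carrier G" and b: "b \<in> carrier G" and ba: "b \<otimes> inv a \<in> U" for a b
  proof -
    have *: "b \<otimes> inv c \<in> U \<longleftrightarrow> a \<otimes> inv c \<in> U" if c: "c \<in> carrier G" for c
    proof -
      have "b \<otimes> inv c = b \<otimes> inv a \<otimes> (a \<otimes> inv c)"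
        using a b c by (simp add: m_assoc inv_mult_cancel)
      then show ?thesis using U_mult_iff[OF ba, of "a \<otimes> inv c"] a c by simp
    qed
    show ?thesis
      unfolding swap_def *[OF xc] *[OF yc]
      using a b xc yc by (simp add: inv_mult_group m_assoc inv_mult_cancel)
  qed
  show "relation_aut G R ?f"
    unfolding relation_aut_def
  proof (intro conjI ballI)
    show "bij_betw ?f (carrier G) (carrier G)"
      by (rule bij_betw_byWitness[where f' = ?f]) (use invol closed in auto)
    fix a b assume a: "a \<in> carrier G" and b: "b \<in> carrier G"
    note fa = closed[OF a] and fb = closed[OF b]
    let ?z = "b \<otimes> inv a" and ?v = "?f b \<otimes> inv b" and ?w = "a \<otimes> inv (?f a)"
    have w: "?w \<in> V"
      using V_inv[OF moved[OF a]] a fa by (simp add: inv_mult_group)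
    have eq: "?f b \<otimes> inv (?f a) = ?v \<otimes> ?z \<otimes> ?w"
      using a b fa fb by (simp add: m_assoc inv_mult_cancel)
    show "(?z, ?f b \<otimes> inv (?f a)) \<in> R"
    proof (cases "?z \<in> U")
      case True
      then show ?thesis using same[OF a b] a b by (simp add: related_refl)
    next
      case zU: False
      \<comment> \<open>If the image quotient were in \<open>U\<close>, applying \<open>same\<close>
        to the image points would return a quotient in \<open>U\<close>, as the swap is an
        involution.\<close>
      have fU: "?f b \<otimes> inv (?f a) \<notin> U"
        using same[OF fa fb] invol a b zU by auto
      show ?thesis
      proof (cases "?z \<in> V")
        case True
        then have "?f b \<otimes> inv (?f a) \<in> V"
          unfolding eq by (rule V_mult[OF V_mult[OF moved[OF b]] w])
        then show ?thesis
          using True zU fU related_iff_V related_trans related_sym by meson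
      next
        case False
        have 1: "(?z, ?v \<otimes> ?z) \<in> R"
          using V_translate[OF moved[OF b] _ False] a b by simp
        then have "?v \<otimes> ?z \<notin> V" using V_related[OF _ related_sym] False by blast
        then have "(?v \<otimes> ?z, ?v \<otimes> ?z \<otimes> ?w) \<in> R"
          using V_translate_right[OF w] a b fb by simp
        then show ?thesis unfolding eq using 1 related_trans by blast
      qed
    qed
  qed
  have "x \<notin> U" "y \<notin> U" using U_class x y by auto
  then have "inv x \<notin> U" "inv y \<notin> U" using U_inv[of "inv x"] U_inv[of "inv y"] xc yc by auto
  then show "?f \<one> = \<one>" using xc yc by (simp add: swap_def)
  show fx: "?f x = y" using xc yc U_one by (simp add: swap_def)
  show "?f y = x" using invol[OF xc] fx by simp
qed

end

text \<open>Pairs inside \<open>H\<close> are joined by an extended automorphism of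
  \<open>H\<close>, pairs outside by a lifted automorphism of the quotient, and pairs across by a
  swap.\<close>

lemma (in fused_relation) schurian_relation_fused:
  assumes sub: "schurian_relation (G\<lparr>carrier := H\<rparr>) (R \<inter> H \<times> H)"
    and quot: "schurian_relation (G Mod H) quotient_relation"
  shows "schurian_relation G R"
  unfolding schurian_relation_def
proof (intro allI impI)
  fix x y assume xy: "(x, y) \<in> R"
  note xc = related_carrier(1)[OF xy] and yc = related_carrier(2)[OF xy]
  have H: "subgroup H G" ..
  have mixed: "\<exists>f. relation_aut G R f \<and> f \<one> = \<one> \<and> f a = b \<and> f b = a"
    if ab: "(a, b) \<in> R" "a \<in> H" "b \<notin> H" for a b
  proof -
    interpret mixed_class G R H a b by unfold_locales (fact ab)+
    have "a \<otimes> inv b \<notin> U"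
      using ab U_subset H_mult_iff(1)[of "inv b" a] H_inv_iff related_carrier by blast
    then show ?thesis
      using relation_aut_swap[of a b] ab(1) related_carrier[OF ab(1)] related_refl by blast
  qed
  show "\<exists>f. relation_aut G R f \<and> f \<one> = \<one> \<and> f x = y"
  proof (cases "x \<in> H"; cases "y \<in> H")
    assume "x \<in> H" "y \<in> H"
    then obtain f where f: "relation_aut (G\<lparr>carrier := H\<rparr>) (R \<inter> H \<times> H) f" "f \<one> = \<one>" "f x = y"
      using sub xy unfolding schurian_relation_def by force
    then show ?thesis
      using relation_aut_extend[OF f(1)] \<open>x \<in> H\<close> subgroup.one_closed[OF H]
      by (intro exI[of _ "\<lambda>x. if x \<in> H then f x else x"]) simp
  next
    assume xH: "x \<notin> H" and yH: "y \<notin> H"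
    then have "(H #> x, H #> y) \<in> quotient_relation"
      using xy xc yc by (simp add: quotient_relation_iff)
    then obtain f where f: "relation_aut (G Mod H) quotient_relation f" "f H = H" "f (H #> x) = H #> y"
      using quot unfolding schurian_relation_def by force
    \<comment> \<open>The identity represents \<open>H\<close>, so the lift fixes it. Using
      \<open>r x\<close> at the source and \<open>r y\<close> at the target makes the lift send
      \<open>x\<close> to \<open>y\<close>; the remaining representatives are arbitrary.\<close>
    define r where "r u C = (if C = H then \<one> else if C = H #> u then u else (SOME g. g \<in> C))" for u C
    have r: "r u C \<in> C" if C: "C \<in> carrier (G Mod H)" and u: "u \<in> carrier G" for u C
    proof -
      have "C \<noteq> {}" using C rcos_self[OF _ H] by (auto simp: carrier_FactGroup)
      then show ?thesis
        using rcos_self[OF u H] subgroup.one_closed[OF H] by (auto simp: r_def some_in_eq)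
    qed
    have rH: "r u H = \<one>" for u by (simp add: r_def)
    have ru: "r u (H #> u) = u" if "u \<in> carrier G" "u \<notin> H" for u
      using that coset_eq_H_iff by (simp add: r_def)
    let ?f = "\<lambda>g. g \<otimes> inv (r x (H #> g)) \<otimes> r y (f (H #> g))"
    have "relation_aut G R ?f"
      using f(1) r xc yc by (intro relation_aut_lift) auto
    moreover have "?f \<one> = \<one>"
      using f(2) by (simp add: rH coset_mult_one subset)
    moreover have "?f x = y"
      using f(3) xc yc xH yH by (simp add: ru)
    ultimately show ?thesis by blast
  next
    assume "x \<in> H" "y \<notin> H"
    then show ?thesis using mixed[OF xy] by blast
  next
    assume "x \<notin> H" "y \<in> H"
    then show ?thesis using mixed[OF related_sym[OF xy]] by blast
  qed
qed

text \<open>A coset other than \<open>H\<close> lies in one conjugacy class, and centrality puts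
  that conjugacy class inside one class of \<open>R\<close>.\<close>

lemma Camina_pair_fused:
  assumes "schur_relation G R" "central_relation G R" "Camina_pair G H"
  shows "fused_relation G R H"
proof -
  interpret schur_relation G R by fact
  interpret normal H G using assms(3) by (simp add: Camina_pair_def)
  have H: "subgroup H G" ..
  show ?thesis
  proof
    fix x h assume x: "x \<in> carrier G" "x \<notin> H" and h: "h \<in> H"
    have "H #>\<^bsub>G\<^esub> x \<in> rcosets\<^bsub>G\<^esub> H" using x by (auto simp: RCOSETS_def)
    moreover have xC: "x \<in> H #>\<^bsub>G\<^esub> x" by (rule rcos_self[OF x(1) H])
    moreover have hxC: "h \<otimes>\<^bsub>G\<^esub> x \<in> H #>\<^bsub>G\<^esub> x" using h by (auto simp: r_coset_def)
    ultimately obtain c where c: "c \<in> carrier G" "H #>\<^bsub>G\<^esub> x \<subseteq> conjugacy_class G c"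
      using assms(3) x unfolding Camina_pair_def by blast
    have cR: "(c, y) \<in> R" if y: "y \<in> H #>\<^bsub>G\<^esub> x" for y
    proof -
      obtain g where "g \<in> carrier G" "y = g \<otimes>\<^bsub>G\<^esub> c \<otimes>\<^bsub>G\<^esub> inv\<^bsub>G\<^esub> g"
        using subsetD[OF c(2) y] unfolding conjugacy_class_def by blast
      then show ?thesis using assms(2) c(1) by (simp add: central_relation_def)
    qed
    show "(x, h \<otimes>\<^bsub>G\<^esub> x) \<in> R"
      by (rule related_trans[OF related_sym[OF cR[OF xC]] cR[OF hxC]])
  qed
qed

lemma generalized_Schur_Camina:
  assumes "group G" "finite (carrier G)" and C: "Camina_pair G H"
    and sub: "generalized_Schur (G\<lparr>carrier := H\<rparr>)" and quot: "generalized_Schur (G Mod H)"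
  shows "generalized_Schur G"
  unfolding generalized_Schur_iff[OF assms(1,2)]
proof (intro allI impI)
  fix R assume R: "schur_relation G R \<and> central_relation G R"
  interpret fused_relation G R H
    using R C by (intro Camina_pair_fused) simp_all
  have "schurian_relation (G\<lparr>carrier := H\<rparr>) (R \<inter> H \<times> H)"
  proof -
    interpret S: schur_relation "G\<lparr>carrier := H\<rparr>" "R \<inter> H \<times> H"
      by (rule schur_relation_restrict)
    show ?thesis
      using sub R central_relation_restrict schur_relation_restrict
      unfolding generalized_Schur_iff[OF S.is_group S.fin] by blast
  qed
  moreover have "schurian_relation (G Mod H) quotient_relation"
  proof -
    interpret Q: schur_relation "G Mod H" quotient_relation
      by (rule schur_relation_quotient)
    show ?thesis
      using quot R central_relation_quotient schur_relation_quotient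
      unfolding generalized_Schur_iff[OF Q.is_group Q.fin] by blast
  qed
  ultimately show "schurian_relation G R"
    by (rule schurian_relation_fused)
qed

section \<open>Frobenius groups\<close>

text \<open>Serves to pass from a Frobenius complement to the quotient by the kernel. Relations are
  pulled back along \<phi>, and automorphisms are conjugated by \<phi>.\<close>

lemma generalized_Schur_iso:
  assumes "generalized_Schur A" "group B" and iso: "\<phi> \<in> iso A B"
  shows "generalized_Schur B"
proof -
  have A: "group A" "finite (carrier A)" using assms(1) by (auto simp: generalized_Schur_def)
  have bij: "bij_betw \<phi> (carrier A) (carrier B)" and hom: "\<phi> \<in> hom A B"
    using iso by (auto simp: iso_def)
  interpret group_hom A B \<phi>
    using A assms(2) hom by (simp add: group_hom_def group_hom_axioms_def)
  let ?\<psi> = "inv_into (carrier A) \<phi>"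
  have \<psi>\<phi>: "?\<psi> (\<phi> x) = x" if "x \<in> carrier A" for x
    using bij that by (rule bij_betw_inv_into_left)
  have \<phi>\<psi>: "\<phi> (?\<psi> x) = x" if "x \<in> carrier B" for x
    using bij that by (rule bij_betw_inv_into_right)
  have \<psi>: "?\<psi> x \<in> carrier A" if "x \<in> carrier B" for x
    using bij_betwE[OF bij_betw_inv_into[OF bij]] that by blast
  have "finite (carrier B)" using bij A(2) by (metis bij_betw_finite)
  moreover have "schurian_relation B R" if R: "schur_relation B R" "central_relation B R" for R
  proof -
    interpret R: schur_relation B R by fact
    define Q where "Q = {(x, y). x \<in> carrier A \<and> y \<in> carrier A \<and> (\<phi> x, \<phi> y) \<in> R}"
    have "schur_relation A Q"
    proof
      show "finite (carrier A)" by fact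
      show "equiv (carrier A) Q"
        by (rule equivI)
          (auto simp: Q_def refl_on_def sym_def trans_def
            intro: R.related_refl R.related_sym R.related_trans)
      show "x = \<one>\<^bsub>A\<^esub>" if "(\<one>\<^bsub>A\<^esub>, x) \<in> Q" for x
      proof -
        have "\<phi> x = \<phi> \<one>\<^bsub>A\<^esub>" "x \<in> carrier A" using that R.class_one by (auto simp: Q_def)
        then show ?thesis using \<psi>\<phi> by (metis G.one_closed)
      qed
      show "(inv\<^bsub>A\<^esub> x, inv\<^bsub>A\<^esub> y) \<in> Q" if "(x, y) \<in> Q" for x y
        using that R.inv_related by (auto simp: Q_def)
      fix f g :: "_ \<Rightarrow> int" assume f: "f respects Q" and g: "g respects Q"
      have resp: "(\<lambda>x. k (?\<psi> x)) respects R" if "k respects Q" for k :: "_ \<Rightarrow> int"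
        by (rule congruentI, rule congruentD[OF that])
          (simp add: Q_def \<phi>\<psi> \<psi> R.related_carrier)
      have conv_eq: "conv B (\<lambda>x. f (?\<psi> x)) (\<lambda>x. g (?\<psi> x)) (\<phi> x) = conv A f g x" if x: "x \<in> carrier A" for x
      proof -
        have "conv B (\<lambda>x. f (?\<psi> x)) (\<lambda>x. g (?\<psi> x)) (\<phi> x) =
            (\<Sum>y\<in>carrier A. f (?\<psi> (\<phi> y)) * g (?\<psi> (inv\<^bsub>B\<^esub> \<phi> y \<otimes>\<^bsub>B\<^esub> \<phi> x)))"
          unfolding conv_def by (rule sum.reindex_bij_betw[OF bij, symmetric])
        also have "\<dots> = conv A f g x"
          unfolding conv_def
        proof (rule sum.cong[OF refl])
          fix y assume y: "y \<in> carrier A"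
          have "inv\<^bsub>B\<^esub> \<phi> y \<otimes>\<^bsub>B\<^esub> \<phi> x = \<phi> (inv\<^bsub>A\<^esub> y \<otimes>\<^bsub>A\<^esub> x)"
            using x y by simp
          then show "f (?\<psi> (\<phi> y)) * g (?\<psi> (inv\<^bsub>B\<^esub> \<phi> y \<otimes>\<^bsub>B\<^esub> \<phi> x)) = f y * g (inv\<^bsub>A\<^esub> y \<otimes>\<^bsub>A\<^esub> x)"
            using x y by (simp only: \<psi>\<phi> G.m_closed G.inv_closed)
        qed
        finally show ?thesis .
      qed
      show "conv A f g respects Q"
      proof (rule congruentI)
        fix x y assume "(x, y) \<in> Q"
        then have xy: "x \<in> carrier A" "y \<in> carrier A" "(\<phi> x, \<phi> y) \<in> R" by (auto simp: Q_def)
        show "conv A f g x = conv A f g y"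
          using congruentD[OF R.conv_respects[OF resp[OF f] resp[OF g]] xy(3)] conv_eq xy by simp
      qed
    qed
    moreover have "central_relation A Q"
      using R(2) by (simp add: central_relation_def Q_def)
    ultimately have schur: "schurian_relation A Q"
      using assms(1) unfolding generalized_Schur_iff[OF A] by blast
    show ?thesis
      unfolding schurian_relation_def
    proof (intro allI impI)
      fix x y assume xy: "(x, y) \<in> R"
      note xc = R.related_carrier(1)[OF xy] and yc = R.related_carrier(2)[OF xy]
      have "(?\<psi> x, ?\<psi> y) \<in> Q" using xy xc yc by (simp add: Q_def \<psi> \<phi>\<psi>)
      then obtain f where f: "relation_aut A Q f" "f \<one>\<^bsub>A\<^esub> = \<one>\<^bsub>A\<^esub>" "f (?\<psi> x) = ?\<psi> y"
        using schur unfolding schurian_relation_def by blast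
      have fbij: "bij_betw f (carrier A) (carrier A)"
        and frel: "\<And>a b. a \<in> carrier A \<Longrightarrow> b \<in> carrier A \<Longrightarrow>
          (b \<otimes>\<^bsub>A\<^esub> inv\<^bsub>A\<^esub> a, f b \<otimes>\<^bsub>A\<^esub> inv\<^bsub>A\<^esub> (f a)) \<in> Q"
        using f(1) by (auto simp: relation_aut_def)
      have fc: "f a \<in> carrier A" if "a \<in> carrier A" for a
        using fbij that by (auto dest: bij_betwE)
      let ?f = "\<lambda>b. \<phi> (f (?\<psi> b))"
      have "relation_aut B R ?f"
        unfolding relation_aut_def
      proof (intro conjI ballI)
        show "bij_betw ?f (carrier B) (carrier B)"
          using bij_betw_trans[OF bij_betw_trans[OF bij_betw_inv_into[OF bij] fbij] bij]
          by (simp add: comp_def)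
        fix a b assume ab: "a \<in> carrier B" "b \<in> carrier B"
        then show "(b \<otimes>\<^bsub>B\<^esub> inv\<^bsub>B\<^esub> a, ?f b \<otimes>\<^bsub>B\<^esub> inv\<^bsub>B\<^esub> (?f a)) \<in> R"
          using frel[of "?\<psi> a" "?\<psi> b"] by (simp add: Q_def \<psi> \<phi>\<psi> fc)
      qed
      moreover have "?\<psi> \<one>\<^bsub>B\<^esub> = \<one>\<^bsub>A\<^esub>" using \<psi>\<phi>[of "\<one>\<^bsub>A\<^esub>"] by simp
      then have "?f \<one>\<^bsub>B\<^esub> = \<one>\<^bsub>B\<^esub>" using f(2) by simp
      moreover have "?f x = y" using f(3) yc by (simp add: \<phi>\<psi>)
      ultimately show "\<exists>f. relation_aut B R f \<and> f \<one>\<^bsub>B\<^esub> = \<one>\<^bsub>B\<^esub> \<and> f x = y" by blast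
    qed
  qed
  ultimately show ?thesis
    using generalized_Schur_iff[OF assms(2)] by blast
qed

section \<open>Kernel and complement of a Frobenius group\<close>

context group begin

lemma conjugate_mem_iff:
  assumes "K \<subseteq> carrier G" "g \<in> carrier G" "x \<in> carrier G"
  shows "x \<in> g <# K #> inv g \<longleftrightarrow> inv g \<otimes> x \<otimes> g \<in> K"
proof
  assume "x \<in> g <# K #> inv g"
  then obtain k where "k \<in> K" "x = g \<otimes> k \<otimes> inv g"
    by (auto simp: r_coset_def l_coset_def)
  then show "inv g \<otimes> x \<otimes> g \<in> K"
    using assms by (simp add: m_assoc inv_mult_cancel subset_eq)
next
  assume "inv g \<otimes> x \<otimes> g \<in> K"
  moreover have "x = g \<otimes> (inv g \<otimes> x \<otimes> g) \<otimes> inv g"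
    using assms by (simp add: m_assoc inv_mult_cancel)
  ultimately show "x \<in> g <# K #> inv g"
    unfolding r_coset_def l_coset_def by blast
qed

lemma Frobenius_kernel_iff:
  assumes "K \<subseteq> carrier G"
  shows "x \<in> Frobenius_kernel G K \<longleftrightarrow>
    x = \<one> \<or> x \<in> carrier G \<and> (\<forall>g\<in>carrier G. inv g \<otimes> x \<otimes> g \<notin> K)"
  using conjugate_mem_iff[OF assms] by (auto simp: Frobenius_kernel_def)

text \<open>The assumed group structure gives closure under products and inverses. Conjugation by
  \<open>g\<close> is absorbed because membership is a condition over all conjugating
  elements.\<close>

lemma Frobenius_kernel_normal:
  assumes K: "K \<subseteq> carrier G" and N: "group (G\<lparr>carrier := Frobenius_kernel G K\<rparr>)"
  shows "Frobenius_kernel G K \<lhd> G"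
proof -
  let ?N = "Frobenius_kernel G K"
  note iff = Frobenius_kernel_iff[OF K]
  interpret N: group "G\<lparr>carrier := ?N\<rparr>" by fact
  have sub: "?N \<subseteq> carrier G" using iff by auto
  have "subgroup ?N G"
  proof (rule subgroupI)
    show "?N \<subseteq> carrier G" by fact
    show "?N \<noteq> {}" using iff[of \<one>] by auto
    show "a \<otimes> b \<in> ?N" if "a \<in> ?N" "b \<in> ?N" for a b
      using N.m_closed that by simp
    show "inv a \<in> ?N" if a: "a \<in> ?N" for a
    proof -
      obtain b where b: "b \<in> ?N" "b \<otimes> a = \<one>"
        using N.l_inv_ex a by auto
      then have "inv a = b" using a sub by (intro inv_equality) auto
      then show ?thesis using b by simp
    qed
  qed
  moreover have "g \<otimes> x \<otimes> inv g \<in> ?N" if g: "g \<in> carrier G" and x: "x \<in> ?N" for g x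
  proof (cases "x = \<one>")
    case True
    then show ?thesis using g iff by simp
  next
    case False
    then have xc: "x \<in> carrier G" and *: "\<And>h. h \<in> carrier G \<Longrightarrow> inv h \<otimes> x \<otimes> h \<notin> K"
      using x iff by auto
    have "inv h \<otimes> (g \<otimes> x \<otimes> inv g) \<otimes> h \<notin> K" if h: "h \<in> carrier G" for h
      using *[of "inv g \<otimes> h"] g h xc by (simp add: inv_mult_group m_assoc)
    then show ?thesis using iff g xc by simp
  qed
  ultimately show ?thesis unfolding normal_inv_iff by blast
qed

text \<open>Conjugates of \<open>K\<close> are indexed by the cosets of \<open>K\<close>, so the non-identity elements of their
  union number at most \<open>[G:K] (|K| - 1)\<close>, and the kernel has at least \<open>[G:K]\<close> elements.\<close>

lemma card_Frobenius_kernel: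
  assumes K: "subgroup K G" and fin: "finite (carrier G)"
  shows "card (carrier G) \<le> card (Frobenius_kernel G K) * card K"
proof -
  let ?N = "Frobenius_kernel G K"
  have Kc: "K \<subseteq> carrier G" using K by (rule subgroup.subset)
  have finK: "finite K" using Kc fin by (rule finite_subset)
  note iff = Frobenius_kernel_iff[OF Kc]
  define r where "r C = (SOME g. g \<in> C)" for C :: "'a set"
  have r: "r C \<in> carrier G" "K #> r C = C" if CR: "C \<in> rcosets K" for C
  proof -
    obtain g where g: "g \<in> carrier G" and C: "C = K #> g"
      using CR by (auto simp: RCOSETS_def)
    have "r C \<in> C"
      using subgroup.rcosets_non_empty[OF K CR] by (simp add: r_def some_in_eq)
    then have "r C \<in> K #> g" unfolding C .
    then show "r C \<in> carrier G" "K #> r C = C"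
      unfolding C using r_coset_subset_G[OF Kc g] repr_independence[OF _ g K] by auto
  qed
  \<comment> \<open>For a right coset \<open>K #> g\<close> the associated conjugate of
    \<open>K\<close> is by \<open>inv g\<close>, which explains the position of the
    inverses.\<close>
  have cover: "carrier G - ?N \<subseteq> (\<Union>C\<in>rcosets K. (\<lambda>k. inv (r C) \<otimes> k \<otimes> r C) ` (K - {\<one>}))"
  proof
    fix x assume x: "x \<in> carrier G - ?N"
    then obtain g where g: "g \<in> carrier G" "inv g \<otimes> x \<otimes> g \<in> K" and x1: "x \<noteq> \<one>"
      using iff by auto
    let ?C = "K #> inv g" and ?k = "inv g \<otimes> x \<otimes> g"
    have C: "?C \<in> rcosets K" using g by (auto simp: RCOSETS_def)
    have "r ?C \<in> K #> inv g"
      using rcos_self[OF r(1)[OF C] K] r(2)[OF C] by simp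
    then obtain k where k: "k \<in> K" "r ?C = k \<otimes> inv g" by (auto simp: r_coset_def)
    have kc: "k \<in> carrier G" using k Kc by auto
    \<comment> \<open>Replacing \<open>inv g\<close> by the chosen representative
      \<open>k \<otimes> inv g\<close> conjugates \<open>?k\<close> by \<open>k\<close>, which stays
      in \<open>K\<close>.\<close>
    have eq: "inv (r ?C) \<otimes> (k \<otimes> ?k \<otimes> inv k) \<otimes> r ?C = x"
      using g x k(2) kc by (simp add: inv_mult_group m_assoc inv_mult_cancel)
    moreover have "k \<otimes> ?k \<otimes> inv k \<in> K"
      using k(1) g(2) K by (simp add: subgroup.m_closed subgroup.m_inv_closed)
    moreover have "k \<otimes> ?k \<otimes> inv k \<noteq> \<one>"
      using eq r(1)[OF C] x1 by auto
    ultimately show "x \<in> (\<Union>C\<in>rcosets K. (\<lambda>k. inv (r C) \<otimes> k \<otimes> r C) ` (K - {\<one>}))"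
      using C by (intro UN_I[of ?C]) (auto intro!: image_eqI[of x _ "k \<otimes> ?k \<otimes> inv k"])
  qed
  have finR: "finite (rcosets K)"
    using fin by (simp add: RCOSETS_def)
  have one: "\<one> \<in> K" using K by (rule subgroup.one_closed)
  have "card (carrier G - ?N) \<le> card (\<Union>C\<in>rcosets K. (\<lambda>k. inv (r C) \<otimes> k \<otimes> r C) ` (K - {\<one>}))"
    using finR finK by (intro card_mono[OF _ cover]) auto
  also have "\<dots> \<le> (\<Sum>C\<in>rcosets K. card ((\<lambda>k. inv (r C) \<otimes> k \<otimes> r C) ` (K - {\<one>})))"
    by (rule card_UN_le[OF finR])
  also have "\<dots> \<le> (\<Sum>C\<in>rcosets K. card K - 1)"
  proof (rule sum_mono)
    fix C show "card ((\<lambda>k. inv (r C) \<otimes> k \<otimes> r C) ` (K - {\<one>})) \<le> card K - 1"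
      using card_image_le[of "K - {\<one>}"] finK one by (metis card_Diff_singleton finite_Diff)
  qed
  also have "\<dots> = card (rcosets K) * card K - card (rcosets K)"
    by (simp add: diff_mult_distrib2)
  also have "\<dots> = card (carrier G) - card (rcosets K)"
    using lagrange[OF K] by (simp add: order_def)
  finally have 1: "card (carrier G - ?N) \<le> card (carrier G) - card (rcosets K)" .
  have Nsub: "?N \<subseteq> carrier G" using iff by auto
  \<comment> \<open>Ensures that the natural number subtraction in \<open>1\<close> is not
    truncated.\<close>
  have "card (rcosets K) \<le> card (carrier G)"
    using lagrange[OF K] one finK by (metis card_gt_0_iff empty_iff le_refl mult_le_mono nat_mult_1_right order_def Suc_leI One_nat_def)
  then have "card (rcosets K) \<le> card ?N"
    using 1 card_Diff_subset[OF finite_subset[OF Nsub fin] Nsub] card_mono[OF fin Nsub] by linarith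
  then show ?thesis
    using lagrange[OF K] by (metis mult_le_mono1 order_def)
qed

lemma Frobenius_kernel_inter:
  assumes "subgroup K G"
  shows "x \<in> Frobenius_kernel G K \<Longrightarrow> x \<in> K \<Longrightarrow> x = \<one>"
  using Frobenius_kernel_iff[OF subgroup.subset[OF assms], of x] subgroup.mem_carrier[OF assms]
  by (auto dest: bspec[of _ _ \<one>])

text \<open>Injective because the kernel meets \<open>K\<close> trivially, and onto because
  \<open>card_Frobenius_kernel\<close> bounds the number of cosets of the kernel by the order of
  \<open>K\<close>.\<close>

lemma Frobenius_complement_iso:
  assumes K: "subgroup K G" and fin: "finite (carrier G)"
    and N: "group (G\<lparr>carrier := Frobenius_kernel G K\<rparr>)"
  shows "(\<lambda>k. Frobenius_kernel G K #> k) \<in> iso (G\<lparr>carrier := K\<rparr>) (G Mod Frobenius_kernel G K)"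
proof -
  let ?N = "Frobenius_kernel G K"
  have Kc: "K \<subseteq> carrier G" using K by (rule subgroup.subset)
  interpret N: normal ?N G by (rule Frobenius_kernel_normal[OF Kc N])
  have N: "subgroup ?N G" ..
  have inj: "inj_on (\<lambda>k. ?N #> k) K"
  proof (rule inj_onI)
    fix a b assume ab: "a \<in> K" "b \<in> K" "?N #> a = ?N #> b"
    have c: "a \<in> carrier G" "b \<in> carrier G" using ab Kc by auto
    have "a \<in> ?N #> b" using rcos_self[OF c(1) N] ab(3) by simp
    then obtain n where n: "n \<in> ?N" "a = n \<otimes> b" by (auto simp: r_coset_def)
    then have "n = a \<otimes> inv b" using c N.subset by (simp add: m_assoc subset_eq)
    then have "n \<in> K" using ab K by (simp add: subgroup.m_closed subgroup.m_inv_closed)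
    then have "n = \<one>" using Frobenius_kernel_inter[OF K] n by blast
    then show "a = b" using n c by simp
  qed
  have finR: "finite (rcosets ?N)" using fin by (simp add: RCOSETS_def)
  have "(\<lambda>k. ?N #> k) ` K = rcosets ?N"
  proof (rule card_seteq[OF finR])
    show "(\<lambda>k. ?N #> k) ` K \<subseteq> rcosets ?N" using Kc by (auto simp: RCOSETS_def)
    have "card (rcosets ?N) * card ?N \<le> card K * card ?N"
      using card_Frobenius_kernel[OF K fin] lagrange[OF N] by (simp add: order_def mult.commute)
    moreover have "card ?N \<noteq> 0"
      unfolding card_eq_0_iff using finite_subset[OF N.subset fin] subgroup.one_closed[OF N] by blast
    ultimately have "card (rcosets ?N) \<le> card K" by simp
    then show "card (rcosets ?N) \<le> card ((\<lambda>k. ?N #> k) ` K)"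
      using inj by (simp add: card_image)
  qed
  moreover have "(\<lambda>k. ?N #> k) \<in> hom (G\<lparr>carrier := K\<rparr>) (G Mod ?N)"
    using Kc by (auto simp: hom_def carrier_FactGroup N.rcos_sum subset_eq)
  ultimately show ?thesis
    using inj by (simp add: iso_iff FactGroup_def)
qed

lemma Frobenius_Camina_pair:
  assumes K: "Frobenius_complement G K" and fin: "finite (carrier G)"
    and N: "group (G\<lparr>carrier := Frobenius_kernel G K\<rparr>)"
  shows "Camina_pair G (Frobenius_kernel G K)"
proof -
  let ?N = "Frobenius_kernel G K"
  have sub: "subgroup K G" and proper: "K \<noteq> carrier G" and nontriv: "K \<noteq> {\<one>}"
    and inter: "\<And>g. g \<in> carrier G \<Longrightarrow> g \<notin> K \<Longrightarrow> K \<inter> (g <# K #> inv g) = {\<one>}"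
    using K by (auto simp: Frobenius_complement_def)
  have Kc: "K \<subseteq> carrier G" using sub by (rule subgroup.subset)
  have one: "\<one> \<in> K" using sub by (rule subgroup.one_closed)
  interpret N: normal ?N G by (rule Frobenius_kernel_normal[OF Kc N])
  have Nsub: "subgroup ?N G" ..
  have finN: "finite ?N" using N.subset fin by (rule finite_subset)
  have cosets: "rcosets ?N = (\<lambda>k. ?N #> k) ` K"
    using Frobenius_complement_iso[OF sub fin N] by (auto simp: iso_iff FactGroup_def)
  show ?thesis
    unfolding Camina_pair_def
  proof (intro conjI ballI impI)
    show "?N \<lhd> G" ..
    show "?N \<noteq> carrier G"
      using Frobenius_kernel_inter[OF sub] Kc one nontriv by blast
    show "?N \<noteq> {\<one>}"
    proof
      assume "?N = {\<one>}"
      then have "card (carrier G) \<le> card K" using card_Frobenius_kernel[OF sub fin] by simp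
      then show False using proper card_seteq[OF fin Kc] by blast
    qed
    fix C assume "C \<in> rcosets ?N" and C: "C \<noteq> ?N"
    then obtain k where k: "k \<in> K" "C = ?N #> k" unfolding cosets by blast
    have kc: "k \<in> carrier G" using k Kc by auto
    have k1: "k \<noteq> \<one>" using k C N.subset by auto
    have inj: "inj_on (\<lambda>n. n \<otimes> k \<otimes> inv n) ?N"
    proof (rule inj_onI)
      fix a b assume ab: "a \<in> ?N" "b \<in> ?N" "a \<otimes> k \<otimes> inv a = b \<otimes> k \<otimes> inv b"
      have c: "a \<in> carrier G" "b \<in> carrier G" using ab N.subset by auto
      \<comment> \<open>This element of the kernel centralizes \<open>k\<close>, so \<open>k\<close>
        lies in both \<open>K\<close> and its conjugate by \<open>?g\<close>. The complement
        condition then forces \<open>?g\<close> into \<open>K\<close>, where the kernel has only the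
        identity.\<close>
      let ?g = "inv b \<otimes> a"
      have gN: "?g \<in> ?N" using ab Nsub by (simp add: subgroup.m_closed subgroup.m_inv_closed)
      have "inv b \<otimes> (a \<otimes> k \<otimes> inv a) \<otimes> b = k"
        unfolding ab(3) using c kc by (simp add: m_assoc inv_mult_cancel)
      then have "?g \<otimes> k \<otimes> inv ?g = k" using c kc by (simp add: inv_mult_group m_assoc)
      then have "k \<in> ?g <# K #> inv ?g"
        using k(1) unfolding r_coset_def l_coset_def by blast
      then have "?g \<in> K" using inter[of ?g] k(1) k1 c by auto
      then have "?g = \<one>" using Frobenius_kernel_inter[OF sub gN] by blast
      then show "a = b" using c by (metis inv_closed inv_equality inv_inv)
    qed
    have "(\<lambda>n. n \<otimes> k \<otimes> inv n) ` ?N = ?N #> k"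
    proof (rule card_seteq)
      show "finite (?N #> k)" using finN by (simp add: r_coset_def)
      show "(\<lambda>n. n \<otimes> k \<otimes> inv n) ` ?N \<subseteq> ?N #> k"
      proof (rule image_subsetI)
        fix n assume n: "n \<in> ?N"
        have nc: "n \<in> carrier G" using n by simp
        have "k \<otimes> inv n \<otimes> inv k \<in> ?N" using n kc by (simp add: N.inv_op_closed2)
        then have "n \<otimes> (k \<otimes> inv n \<otimes> inv k) \<in> ?N"
          using n Nsub by (simp add: subgroup.m_closed)
        moreover have "n \<otimes> k \<otimes> inv n = n \<otimes> (k \<otimes> inv n \<otimes> inv k) \<otimes> k"
          using nc kc by (simp add: m_assoc)
        ultimately show "n \<otimes> k \<otimes> inv n \<in> ?N #> k" unfolding r_coset_def by blast
      qed
      have "?N #> k \<in> rcosets ?N" using kc by (auto simp: RCOSETS_def)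
      then have "card (?N #> k) = card ?N"
        using card_rcosets_equal[OF _ N.subset] by simp
      then show "card (?N #> k) \<le> card ((\<lambda>n. n \<otimes> k \<otimes> inv n) ` ?N)"
        using inj by (simp add: card_image)
    qed
    then show "\<exists>x\<in>carrier G. C \<subseteq> conjugacy_class G x"
      unfolding k(2) conjugacy_class_def using kc N.subset by blast
  qed
qed

end

theorem theorem1p2:
  fixes G :: "('a, 'b) monoid_scheme"
  assumes "group G" and "finite (carrier G)"
  shows "(\<forall>H. Camina_pair G H \<and>
              generalized_Schur (G\<lparr>carrier := H\<rparr>) \<and>
              generalized_Schur (G Mod H) \<longrightarrow>
              generalized_Schur G) \<and>
         (\<forall>K. Frobenius_complement G K \<and>
              generalized_Schur (G\<lparr>carrier := Frobenius_kernel G K\<rparr>) \<and>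
              generalized_Schur (G\<lparr>carrier := K\<rparr>) \<longrightarrow>
              generalized_Schur G)"
proof (intro conjI allI impI)
  fix H
  assume "Camina_pair G H \<and> generalized_Schur (G\<lparr>carrier := H\<rparr>) \<and> generalized_Schur (G Mod H)"
  then show "generalized_Schur G"
    using generalized_Schur_Camina[OF assms] by blast
next
  interpret group G by fact
  fix K
  let ?N = "Frobenius_kernel G K"
  assume K: "Frobenius_complement G K \<and> generalized_Schur (G\<lparr>carrier := ?N\<rparr>) \<and>
    generalized_Schur (G\<lparr>carrier := K\<rparr>)"
  then have N: "group (G\<lparr>carrier := ?N\<rparr>)" and sub: "subgroup K G"
    by (auto simp: generalized_Schur_def Frobenius_complement_def)
  have Camina: "Camina_pair G ?N"
    using Frobenius_Camina_pair K N assms(2) by blast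
  then have "group (G Mod ?N)"
    by (simp add: Camina_pair_def normal.factorgroup_is_group)
  then have "generalized_Schur (G Mod ?N)"
    using generalized_Schur_iso Frobenius_complement_iso[OF sub assms(2) N] K by blast
  then show "generalized_Schur G"
    using generalized_Schur_Camina[OF assms Camina] K by blast
qed

end
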